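(* Let $\mathcal{A}$ be a computable equivalence structure. (1) If $\mathcal{A}$ has bounded character and finitely many infinite equivalence classes, then its degree of bi-embeddable categoricity is $\mathbf{0}$. (2) If $\mathcal{A}$ has unbounded character and finitely many infinite equivalence classes, then its degree of bi-embeddable categoricity is $\mathbf{0}'$. (3) If $\mathcal{A}$ has infinitely many infinite equivalence classes, then its degree of bi-embeddable categoricity is $\mathbf{0}''$. Thus the degree of bi-embeddable categoricity of a computable equivalence structure is $\mathbf{0}$, $\mathbf{0}'$, or $\mathbf{0}''$. Furthermore, these degrees of bi-embeddable categoricity are strong.
   Context: An equivalence structure $\mathcal{A}=(A,E)$ has universe $A\subseteq\omega$ and an equivalence relation $E$ on $A$; it is computable if $A$ is computable and its atomic diagram is computable. Two structures are bi-embeddable if each embeds into the other; a structure bi-embeddable with $\mathcal{A}$ is a bi-embeddable copy of $\mathcal{A}$. $\mathcal{A}$ has bounded character if there is a finite $k$ such that all finite equivalence classes of $\mathcal{A}$ have size at most $k$; otherwise it has unbounded character. The degree of bi-embeddable categoricity of a computable structure $\mathcal{A}$ is the least Turing degree $\mathbf{d}$ (if it exists) such that for any two computable bi-embeddable copies of $\mathcal{A}$, $\mathbf{d}$ computes embeddings between them in both directions. It is the strong degree of bi-embeddable categoricity if, in addition, $\mathcal{A}$ has two computable bi-embeddable copies $\mathcal{A}_0,\mathcal{A}_1$ such that for all embeddings $\mu:\mathcal{A}_0\hookrightarrow\mathcal{A}_1$ and $\nu:\mathcal{A}_1\hookrightarrow\mathcal{A}_0$, $\mu\oplus\nu\geq_T\mathbf{d}$.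 *)

theory Defs
  imports Main "HOL-Library.Nat_Bijection"
begin

datatype rf = Z | S | Ident | Fst | Snd | Orc
  | Comp rf rf | Pair rf rf | Rec rf rf | Mu rf

inductive eval :: "(nat \<Rightarrow> nat) \<Rightarrow> rf \<Rightarrow> nat \<Rightarrow> nat \<Rightarrow> bool" for f where
  ev_Z: "eval f Z x 0"
| ev_S: "eval f S x (Suc x)"
| ev_Id: "eval f Ident x x"
| ev_Fst: "eval f Fst x (fst (prod_decode x))"
| ev_Snd: "eval f Snd x (snd (prod_decode x))"
| ev_Orc: "eval f Orc x (f x)"
| ev_Comp: "eval f q x y \<Longrightarrow> eval f p y z \<Longrightarrow> eval f (Comp p q) x z"
| ev_Pair: "eval f p x y \<Longrightarrow> eval f q x z \<Longrightarrow> eval f (Pair p q) x (prod_encode (y, z))"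
| ev_Rec0: "eval f p x y \<Longrightarrow> eval f (Rec p q) (prod_encode (x, 0)) y"
| ev_RecS: "eval f (Rec p q) (prod_encode (x, n)) y \<Longrightarrow>
            eval f q (prod_encode (prod_encode (x, n), y)) z \<Longrightarrow>
            eval f (Rec p q) (prod_encode (x, Suc n)) z"
| ev_Mu: "eval f p (prod_encode (x, n)) 0 \<Longrightarrow>
          (\<forall>m<n. \<exists>k. 0 < k \<and> eval f p (prod_encode (x, m)) k) \<Longrightarrow>
          eval f (Mu p) x n"

fun code :: "rf \<Rightarrow> nat" where
  "code Z = 0" | "code S = 1" | "code Ident = 2" | "code Fst = 3" | "code Snd = 4"
| "code Orc = 5"
| "code (Comp p q) = 10 * prod_encode (code p, code q) + 6"
| "code (Pair p q) = 10 * prod_encode (code p, code q) + 7"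
| "code (Rec p q) = 10 * prod_encode (code p, code q) + 8"
| "code (Mu p) = 10 * code p + 9"

definition chi :: "nat set \<Rightarrow> nat \<Rightarrow> nat" where
  "chi X n = (if n \<in> X then 1 else 0)"

definition computable_on_from :: "(nat \<Rightarrow> nat) \<Rightarrow> nat set \<Rightarrow> (nat \<Rightarrow> nat) \<Rightarrow> bool" where
  "computable_on_from f D g \<longleftrightarrow> (\<exists>p. \<forall>n\<in>D. eval f p n (g n))"

definition set_le_fun :: "nat set \<Rightarrow> (nat \<Rightarrow> nat) \<Rightarrow> bool" where
  "set_le_fun X f \<longleftrightarrow> computable_on_from f UNIV (chi X)"

definition turing_le :: "nat set \<Rightarrow> nat set \<Rightarrow> bool" where
  "turing_le X Y \<longleftrightarrow> set_le_fun X (chi Y)"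

definition computable_set :: "nat set \<Rightarrow> bool" where
  "computable_set X \<longleftrightarrow> turing_le X {}"

definition jump :: "nat set \<Rightarrow> nat set" where
  "jump X = {code p | p. \<exists>y. eval (chi X) p (code p) y}"

definition join :: "(nat \<Rightarrow> nat) \<Rightarrow> (nat \<Rightarrow> nat) \<Rightarrow> nat \<Rightarrow> nat" where
  "join g h n = (if even n then g (n div 2) else h (n div 2))"

definition rel_code :: "(nat \<times> nat) set \<Rightarrow> nat set" where
  "rel_code E = {prod_encode (x, y) | x y. (x, y) \<in> E}"

text \<open>A structure (A,E): universe A, binary relation E on A. It is computable if
  A is computable and its atomic diagram (equivalently E) is computable.\<close>
definition computable_structure :: "nat set \<Rightarrow> (nat \<times> nat) set \<Rightarrow> bool" where
  "computable_structure A E \<longleftrightarrow> E \<subseteq> A \<times> A \<and> computable_set A \<and> computable_set (rel_code E)"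

definition computable_equiv_structure :: "nat set \<Rightarrow> (nat \<times> nat) set \<Rightarrow> bool" where
  "computable_equiv_structure A E \<longleftrightarrow> computable_structure A E \<and> equiv A E"

definition embedding ::
  "nat set \<Rightarrow> (nat \<times> nat) set \<Rightarrow> nat set \<Rightarrow> (nat \<times> nat) set \<Rightarrow> (nat \<Rightarrow> nat) \<Rightarrow> bool" where
  "embedding A E B F \<mu> \<longleftrightarrow> \<mu> ` A \<subseteq> B \<and> inj_on \<mu> A \<and>
     (\<forall>x\<in>A. \<forall>y\<in>A. (x, y) \<in> E \<longleftrightarrow> (\<mu> x, \<mu> y) \<in> F)"

definition bi_embeddable ::
  "nat set \<Rightarrow> (nat \<times> nat) set \<Rightarrow> nat set \<Rightarrow> (nat \<times> nat) set \<Rightarrow> bool" where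
  "bi_embeddable A E B F \<longleftrightarrow> (\<exists>\<mu>. embedding A E B F \<mu>) \<and> (\<exists>\<nu>. embedding B F A E \<nu>)"

definition comp_be_copy :: "nat set \<Rightarrow> (nat \<times> nat) set \<Rightarrow> nat set \<Rightarrow> (nat \<times> nat) set \<Rightarrow> bool" where
  "comp_be_copy A E B F \<longleftrightarrow> computable_structure B F \<and> bi_embeddable A E B F"

definition bounded_character :: "nat set \<Rightarrow> (nat \<times> nat) set \<Rightarrow> bool" where
  "bounded_character A E \<longleftrightarrow> (\<exists>k. \<forall>x\<in>A. finite (E `` {x}) \<longrightarrow> card (E `` {x}) \<le> k)"

definition finitely_many_infinite_classes :: "nat set \<Rightarrow> (nat \<times> nat) set \<Rightarrow> bool" where
  "finitely_many_infinite_classes A E \<longleftrightarrow> finite {E `` {x} | x. x \<in> A \<and> infinite (E `` {x})}"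

definition bec_computes :: "nat set \<Rightarrow> nat set \<Rightarrow> (nat \<times> nat) set \<Rightarrow> bool" where
  "bec_computes D A E \<longleftrightarrow>
     (\<forall>B F C G. comp_be_copy A E B F \<longrightarrow> comp_be_copy A E C G \<longrightarrow>
        (\<exists>\<mu>. embedding B F C G \<mu> \<and> computable_on_from (chi D) B \<mu>) \<and>
        (\<exists>\<nu>. embedding C G B F \<nu> \<and> computable_on_from (chi D) C \<nu>))"

definition degree_of_bec :: "nat set \<Rightarrow> nat set \<Rightarrow> (nat \<times> nat) set \<Rightarrow> bool" where
  "degree_of_bec D A E \<longleftrightarrow> bec_computes D A E \<and> (\<forall>Y. bec_computes Y A E \<longrightarrow> turing_le D Y)"

definition strong_degree_of_bec :: "nat set \<Rightarrow> nat set \<Rightarrow> (nat \<times> nat) set \<Rightarrow> bool" where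
  "strong_degree_of_bec D A E \<longleftrightarrow> degree_of_bec D A E \<and>
     (\<exists>B0 F0 B1 F1. comp_be_copy A E B0 F0 \<and> comp_be_copy A E B1 F1 \<and>
        (\<forall>\<mu> \<nu>. embedding B0 F0 B1 F1 \<mu> \<longrightarrow> embedding B1 F1 B0 F0 \<nu> \<longrightarrow>
           set_le_fun D (join \<mu> \<nu>)))"

end

theory Submission
  imports Defs
begin

text \<open>
  Relative to an oracle, an embedding is determined by an injection of classes that does not decrease
  sizes: match the \<open>k\<close>-th element of a class with the \<open>k\<close>-th element of its target. A greedy search
  produces such an injection as soon as the oracle can recognise sufficiently large targets. For
  bounded character a fixed number of elements suffices, so nothing is needed; for unbounded character the
  size comparison is a universal condition; in the last case one sends every class to an infinite one,
  which \<open>\<emptyset>''\<close> recognises.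

  For the lower bounds take structures whose classes are the columns of a computable set. In the second
  case one structure has known column sizes, while in the other the column of \<open>e\<close> outgrows the stage at which
  \<open>e\<close> enters \<open>\<emptyset>'\<close>: the size of its image bounds that stage. In the third case all columns of one
  structure are infinite, while in the other exactly those are infinite whose index codes an initial segment of
  the function giving the least \<open>\<emptyset>'\<close>-enumeration stages of the elements of \<open>\<emptyset>''\<close>. Being such an index is a
  \<open>\<Pi>\<^sub>2\<close> condition, and any infinite set of such indices computes \<open>\<emptyset>''\<close>.
\<close>

section \<open>Closure properties of relative computability\<close>

text \<open>The type \<open>rf\<close> comes with neither a universal program nor a step counter.
  Both are obtained by iterating a monotone operator on finite sets of coded facts, where stage
  \<open>s\<close> contains only numbers below \<open>s\<close>. This cutoff makes every stage a
  single number, so that membership is decidable, and it bounds the oracle queries made up to stage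
  \<open>s\<close>; the resulting use principle is what turns predicates decidable in a jump into
  Pi_2 predicates. The obstacle to a greedy search is a class for which suitable targets are too
  scarce to be found by searching: the too large classes in the bounded case, the infinite ones in
  the unbounded case. There are finitely many of them, so their targets are hardwired into the
  program as a finite table, without any uniformity. With infinitely many infinite classes no such
  table exists, and infinite targets have to be recognised by the oracle. All searches run over
  total predicates: outside the universe the search condition is made vacuous, so every constructed
  map is a total computable function even though only its values on the universe matter.\<close>

definition pfst :: "nat \<Rightarrow> nat" where "pfst z = fst (prod_decode z)"
definition psnd :: "nat \<Rightarrow> nat" where "psnd z = snd (prod_decode z)"
definition ppair :: "nat \<Rightarrow> nat \<Rightarrow> nat" where "ppair x y = prod_encode (x, y)"

lemma pfst_ppair [simp]: "pfst (ppair x y) = x" by (simp add: pfst_def ppair_def)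
lemma psnd_ppair [simp]: "psnd (ppair x y) = y" by (simp add: psnd_def ppair_def)
lemma ppair_pfst_psnd [simp]: "ppair (pfst z) (psnd z) = z" by (simp add: pfst_def psnd_def ppair_def)
lemma ppair_eq_iff [simp]: "ppair x y = ppair x' y' \<longleftrightarrow> x = x' \<and> y = y'" by (simp add: ppair_def)
lemma le_ppair1: "x \<le> ppair x y" by (simp add: ppair_def le_prod_encode_1)
lemma le_ppair2: "y \<le> ppair x y" by (simp add: ppair_def le_prod_encode_2)

text \<open>Only total unary functions are treated. Several arguments travel as one code, which
  explains hypotheses of the shape \<open>\<lambda>z. h (pfst z) (psnd z)\<close> in the closure
  rules.\<close>

definition computes :: "(nat \<Rightarrow> nat) \<Rightarrow> (nat \<Rightarrow> nat) \<Rightarrow> bool" where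
  "computes f g \<longleftrightarrow> (\<exists>p. \<forall>x. eval f p x (g x))"

definition decides :: "(nat \<Rightarrow> nat) \<Rightarrow> (nat \<Rightarrow> bool) \<Rightarrow> bool" where
  "decides f P \<longleftrightarrow> computes f (\<lambda>x. if P x then 1 else 0)"

lemma computable_on_from_UNIV: "computable_on_from f UNIV g \<longleftrightarrow> computes f g"
  by (simp add: computable_on_from_def computes_def)

lemma computes_imp_computable_on: "computes f g \<Longrightarrow> computable_on_from f D g"
  by (auto simp: computable_on_from_def computes_def)

lemma set_le_fun_iff: "set_le_fun X f \<longleftrightarrow> decides f (\<lambda>x. x \<in> X)"
  by (simp add: set_le_fun_def computable_on_from_UNIV decides_def chi_def[abs_def])

named_theorems computability

lemma computes_comp: "computes f h \<Longrightarrow> computes f g \<Longrightarrow> computes f (\<lambda>x. h (g x))"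
  unfolding computes_def by (meson ev_Comp)

lemma computes_id [computability]: "computes f (\<lambda>x. x)"
  unfolding computes_def by (meson ev_Id)

lemma computes_zero: "computes f (\<lambda>x. 0)"
  unfolding computes_def by (meson ev_Z)

lemma computes_Suc [computability]: "computes f g \<Longrightarrow> computes f (\<lambda>x. Suc (g x))"
  unfolding computes_def by (meson ev_Comp ev_S)

lemma computes_const [computability]: "computes f (\<lambda>x. c)"
  by (induction c) (auto intro: computes_zero computes_Suc)

lemma computes_pfst [computability]: "computes f g \<Longrightarrow> computes f (\<lambda>x. pfst (g x))"
  unfolding computes_def pfst_def by (meson ev_Comp ev_Fst)

lemma computes_psnd [computability]: "computes f g \<Longrightarrow> computes f (\<lambda>x. psnd (g x))"
  unfolding computes_def psnd_def by (meson ev_Comp ev_Snd)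

lemma computes_ppair [computability]: "computes f g \<Longrightarrow> computes f h \<Longrightarrow> computes f (\<lambda>x. ppair (g x) (h x))"
  unfolding computes_def ppair_def by (meson ev_Pair)

lemma computes_oracle [computability]: "computes f g \<Longrightarrow> computes f (\<lambda>x. f (g x))"
  unfolding computes_def by (meson ev_Comp ev_Orc)

lemma computes_rec [computability]:
  assumes "computes f a" "computes f (\<lambda>z. b (pfst (pfst z)) (psnd (pfst z)) (psnd z))" "computes f n"
  shows "computes f (\<lambda>x. rec_nat (a x) (b x) (n x))"
proof -
  obtain p where p: "\<And>x. eval f p x (a x)" using assms(1) by (auto simp: computes_def)
  obtain q where q: "\<And>z. eval f q z (b (pfst (pfst z)) (psnd (pfst z)) (psnd z))"
    using assms(2) by (auto simp: computes_def)
  have "eval f (Rec p q) (prod_encode (x, k)) (rec_nat (a x) (b x) k)" for x k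
  proof (induction k)
    case 0
    show ?case using ev_Rec0[OF p[of x]] by simp
  next
    case (Suc k)
    have "eval f q (prod_encode (prod_encode (x, k), rec_nat (a x) (b x) k)) (b x k (rec_nat (a x) (b x) k))"
      using q[of "ppair (ppair x k) (rec_nat (a x) (b x) k)"] by (simp, simp add: ppair_def)
    from ev_RecS[OF Suc.IH this] show ?case by simp
  qed
  hence "computes f (\<lambda>z. rec_nat (a (pfst z)) (b (pfst z)) (psnd z))"
    unfolding computes_def by (metis ppair_pfst_psnd ppair_def)
  from computes_comp[OF this computes_ppair[OF computes_id assms(3)]] show ?thesis by simp
qed

lemma computes2: "computes f (\<lambda>z. h (pfst z) (psnd z)) \<Longrightarrow> computes f g1 \<Longrightarrow> computes f g2 \<Longrightarrow> computes f (\<lambda>x. h (g1 x) (g2 x))"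
  using computes_comp[OF _ computes_ppair, of f "\<lambda>z. h (pfst z) (psnd z)" g1 g2] by simp

lemma decides_comp: "decides f P \<Longrightarrow> computes f g \<Longrightarrow> decides f (\<lambda>x. P (g x))"
  unfolding decides_def by (rule computes_comp)

lemma decides2: "decides f (\<lambda>z. P (pfst z) (psnd z)) \<Longrightarrow> computes f g1 \<Longrightarrow> computes f g2 \<Longrightarrow> decides f (\<lambda>x. P (g1 x) (g2 x))"
  unfolding decides_def by (rule computes2[of f "\<lambda>x y. if P x y then 1 else 0"])

section \<open>Arithmetic, connectives, bounded quantifiers and search\<close>

lemma computes_add [computability]: assumes "computes f g" "computes f h" shows "computes f (\<lambda>x. g x + h x)"
proof -
  have "rec_nat a (\<lambda>i r. Suc r) b = a + b" for a b by (induction b) auto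
  then have "(\<lambda>x. g x + h x) = (\<lambda>x. rec_nat (g x) (\<lambda>i r. Suc r) (h x))" by simp
  then show ?thesis by (simp only:) (intro computability assms)
qed

lemma computes_mult [computability]: assumes "computes f g" "computes f h" shows "computes f (\<lambda>x. g x * h x)"
proof -
  have "rec_nat 0 (\<lambda>i r. r + a) b = a * b" for a b :: nat by (induction b) auto
  then have "(\<lambda>x. g x * h x) = (\<lambda>x. rec_nat 0 (\<lambda>i r. r + g x) (h x))" by simp
  then show ?thesis by (simp only:) (intro computability computes_comp[OF assms(1)] assms(2))
qed

lemma computes_pow [computability]: assumes "computes f g" "computes f h" shows "computes f (\<lambda>x. g x ^ h x)"
proof -
  have "rec_nat 1 (\<lambda>i r. r * a) b = a ^ b" for a b :: nat by (induction b) auto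
  then have "(\<lambda>x. g x ^ h x) = (\<lambda>x. rec_nat 1 (\<lambda>i r. r * g x) (h x))" by simp
  then show ?thesis by (simp only:) (intro computability computes_comp[OF assms(1)] assms(2))
qed

lemma computes_diff [computability]: assumes "computes f g" "computes f h" shows "computes f (\<lambda>x. g x - h x)"
proof -
  have pred: "rec_nat 0 (\<lambda>i r. i) b = b - 1" for b :: nat by (cases b) auto
  have "rec_nat a (\<lambda>i r. rec_nat 0 (\<lambda>i r. i) r) b = a - b" for a b :: nat
    by (induction b) (auto simp: pred)
  then have "(\<lambda>x. g x - h x) = (\<lambda>x. rec_nat (g x) (\<lambda>i r. rec_nat 0 (\<lambda>i r. i) r) (h x))" by simp
  then show ?thesis by (simp only:) (intro computability assms)
qed

lemma computes_if [computability]: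
  assumes "decides f P" "computes f g" "computes f h" shows "computes f (\<lambda>x. if P x then g x else h x)"
proof -
  \<comment> \<open>Both branches are evaluated and one is multiplied by 0, which is sound because
    both are total.\<close>
  have "(\<lambda>x. if P x then g x else h x)
      = (\<lambda>x. (if P x then 1 else 0) * g x + (1 - (if P x then 1 else 0)) * h x)" by auto
  then show ?thesis by (simp only:) (intro computability assms assms(1)[unfolded decides_def])
qed

lemma decides_const [computability]: "decides f (\<lambda>x. c)"
  unfolding decides_def by (rule computes_const)

lemma decides_not [computability]: assumes "decides f P" shows "decides f (\<lambda>x. \<not> P x)"
proof -
  have "computes f (\<lambda>x. 1 - (if P x then 1 else 0))" by (intro computability assms)
  then show ?thesis unfolding decides_def by (rule back_subst[of "computes f"]) auto
qed

lemma decides_conj [computability]: assumes "decides f P" "decides f Q" shows "decides f (\<lambda>x. P x \<and> Q x)"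
proof -
  have "computes f (\<lambda>x. if P x then (if Q x then 1 else 0) else 0)" by (intro computability assms)
  then show ?thesis unfolding decides_def by (rule back_subst[of "computes f"]) auto
qed

lemma decides_disj [computability]: assumes "decides f P" "decides f Q" shows "decides f (\<lambda>x. P x \<or> Q x)"
proof -
  have "decides f (\<lambda>x. \<not> (\<not> P x \<and> \<not> Q x))" by (intro computability assms)
  then show ?thesis by simp
qed

lemma decides_imp [computability]: assumes "decides f P" "decides f Q" shows "decides f (\<lambda>x. P x \<longrightarrow> Q x)"
proof -
  have "decides f (\<lambda>x. \<not> P x \<or> Q x)" by (intro computability assms)
  then show ?thesis by (simp only: imp_conv_disj)
qed

lemma decides_zero: assumes "computes f g" shows "decides f (\<lambda>x. g x = 0)"
proof -
  have "computes f (\<lambda>x. 1 - g x)" by (intro computability assms)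
  then show ?thesis unfolding decides_def by (rule back_subst[of "computes f"]) auto
qed

lemma decides_le [computability]: assumes "computes f g" "computes f h" shows "decides f (\<lambda>x. g x \<le> h x)"
proof -
  have "decides f (\<lambda>x. g x - h x = 0)" by (intro computability decides_zero assms)
  then show ?thesis by simp
qed

lemma decides_less [computability]: assumes "computes f g" "computes f h" shows "decides f (\<lambda>x. g x < h x)"
  using decides_le[OF computes_Suc[OF assms(1)] assms(2)] by (simp add: Suc_le_eq)

lemma decides_eq [computability]: assumes "computes f g" "computes f h" shows "decides f (\<lambda>x. g x = h x)"
proof -
  have "decides f (\<lambda>x. g x \<le> h x \<and> h x \<le> g x)" by (intro computability assms)
  then show ?thesis by (simp add: order_eq_iff)
qed

lemma decides_all [computability]:
  assumes "decides f (\<lambda>z. P (pfst z) (psnd z))" "computes f n" shows "decides f (\<lambda>x. \<forall>i<n x. P x i)"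
proof -
  let ?r = "\<lambda>x. rec_nat 1 (\<lambda>i r. if P x i then r else 0)"
  have r: "?r x k = (if \<forall>i<k. P x i then 1 else 0 :: nat)" for x k
    by (induction k) (auto simp: less_Suc_eq)
  have "computes f (\<lambda>x. ?r x (n x))" by (intro computability decides2[OF assms(1)] assms(2))
  then show ?thesis unfolding decides_def r .
qed

lemma decides_ex [computability]:
  assumes "decides f (\<lambda>z. P (pfst z) (psnd z))" "computes f n" shows "decides f (\<lambda>x. \<exists>i<n x. P x i)"
proof -
  have "decides f (\<lambda>x. \<not> (\<forall>i<n x. \<not> P x i))" by (intro computability assms decides2[OF assms(1)])
  then show ?thesis by simp
qed

lemma computes_sum [computability]:
  assumes "computes f (\<lambda>z. g (pfst z) (psnd z))" "computes f n" shows "computes f (\<lambda>x. \<Sum>i<n x. g x i)"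
proof -
  let ?r = "\<lambda>x. rec_nat 0 (\<lambda>i r. r + g x i)"
  have r: "?r x k = (\<Sum>i<k. g x i)" for x k by (induction k) auto
  have "computes f (\<lambda>x. ?r x (n x))" by (intro computability computes2[OF assms(1)] assms(2))
  then show ?thesis unfolding r .
qed

lemma computes_card [computability]:
  assumes "decides f (\<lambda>z. P (pfst z) (psnd z))" "computes f n" shows "computes f (\<lambda>x. card {i. i < n x \<and> P x i})"
proof -
  have "card {i. i < k \<and> P x i} = (\<Sum>i<k. if P x i then 1 else 0)" for x k
  proof -
    have "{i. i < k \<and> P x i} = {i \<in> {..<k}. P x i}" by auto
    then show ?thesis by (simp only: card_eq_sum sum.inter_filter finite_lessThan)
  qed
  moreover have "computes f (\<lambda>x. \<Sum>i<n x. if P x i then 1 else 0)" by (intro computability assms decides2[OF assms(1)])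
  ultimately show ?thesis by simp
qed

lemma computes_Least [computability]:
  assumes "decides f (\<lambda>z. P (pfst z) (psnd z))" "\<And>x. \<exists>n. P x n" shows "computes f (\<lambda>x. LEAST n. P x n)"
proof -
  \<comment> \<open>\<open>Mu\<close> looks for a zero, hence the characteristic function of the
    negation.\<close>
  have "decides f (\<lambda>z. \<not> P (pfst z) (psnd z))" by (intro computability assms)
  then obtain p where p: "\<And>z. eval f p z (if \<not> P (pfst z) (psnd z) then 1 else 0)"
    unfolding decides_def computes_def by blast
  have p': "eval f p (prod_encode (x, n)) (if P x n then 0 else 1)" for x n
    using p[of "ppair x n"] by (cases "P x n") (simp_all, simp_all add: ppair_def)
  have "eval f (Mu p) x (LEAST n. P x n)" for x
  proof (rule ev_Mu)
    show "eval f p (prod_encode (x, LEAST n. P x n)) 0"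
      using p'[of x "LEAST n. P x n"] LeastI_ex[OF assms(2)[of x]] by simp
    show "\<forall>m<LEAST n. P x n. \<exists>k>0. eval f p (prod_encode (x, m)) k"
      using p'[of x] not_less_Least[of _ "P x"] by (metis zero_less_one)
  qed
  then show ?thesis by (auto simp: computes_def)
qed

lemma computes_div [computability]: assumes "computes f g" "computes f h" shows "computes f (\<lambda>x. g x div h x)"
proof -
  \<comment> \<open>The disjunct \<open>b = 0\<close> keeps the search total and reproduces the
    convention \<open>a div 0 = 0\<close>.\<close>
  have d: "(LEAST q. b = 0 \<or> a < b * Suc q) = a div b" for a b :: nat
  proof (cases "b = 0")
    case True then show ?thesis by (auto intro: Least_equality)
  next
    case False
    show ?thesis
    proof (rule Least_equality)
      show "b = 0 \<or> a < b * Suc (a div b)" using False by (simp add: dividend_less_times_div)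
      fix q assume "b = 0 \<or> a < b * Suc q"
      then have "a < Suc q * b" using False by (simp add: mult.commute)
      then have "a div b < Suc q" by (rule less_mult_imp_div_less)
      then show "a div b \<le> q" by simp
    qed
  qed
  have "\<exists>q. h x = 0 \<or> g x < h x * Suc q" for x
    by (metis dividend_less_times_div gr0I mult_Suc_right)
  then have "computes f (\<lambda>x. LEAST q. h x = 0 \<or> g x < h x * Suc q)"
    by (intro computability assms computes_comp[OF assms(1)] computes_comp[OF assms(2)])
  then show ?thesis unfolding d .
qed

lemma computes_mod [computability]: assumes "computes f g" "computes f h" shows "computes f (\<lambda>x. g x mod h x)"
proof -
  have "computes f (\<lambda>x. g x - g x div h x * h x)" by (intro computability assms)
  then show ?thesis by (simp add: minus_div_mult_eq_mod)
qed

lemma decides_even [computability]: assumes "computes f g" shows "decides f (\<lambda>x. even (g x))"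
  unfolding even_iff_mod_2_eq_zero by (intro computability assms)

text \<open>Finitely many values can be built into a program whatever \<open>t\<close> is; this is
  how exceptional classes are treated without help from an oracle.\<close>

lemma computes_finite_patch:
  assumes "computes f g" "finite M" shows "computes f (\<lambda>x. if x \<in> M then t x else g x)"
  using assms(2)
proof (induction M)
  case (insert a M)
  have "computes f (\<lambda>x. if x = a then t a else if x \<in> M then t x else g x)" by (intro computability insert.IH)
  then show ?case by (rule back_subst[of "computes f"]) auto
qed (use assms in simp)

lemma decides_finite: assumes "finite M" shows "decides f (\<lambda>x. x \<in> M)"
  unfolding decides_def using computes_finite_patch[OF computes_const[of f 0] assms, of "\<lambda>x. 1"] .

lemma decides_cong:
  assumes "decides f P" "\<And>x. P x \<longleftrightarrow> Q x" shows "decides f Q"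
  using assms by (simp add: decides_def)

section \<open>Determinism and relativization\<close>

inductive_cases eval_ZE: "eval f Z x y"
inductive_cases eval_SE: "eval f S x y"
inductive_cases eval_IdE: "eval f Ident x y"
inductive_cases eval_FstE: "eval f Fst x y"
inductive_cases eval_SndE: "eval f Snd x y"
inductive_cases eval_OrcE: "eval f Orc x y"
inductive_cases eval_CompE: "eval f (Comp p q) x y"
inductive_cases eval_PairE: "eval f (Pair p q) x y"
inductive_cases eval_RecE: "eval f (Rec p q) x y"
inductive_cases eval_MuE: "eval f (Mu p) x y"

lemma eval_det: "eval f p x y \<Longrightarrow> eval f p x z \<Longrightarrow> y = z"
proof (induction arbitrary: z rule: eval.induct)
  case (ev_Mu p x n)
  from ev_Mu.prems obtain
    a: "eval f p (prod_encode (x, z)) 0" and b: "\<And>m. m < z \<Longrightarrow> \<exists>k>0. eval f p (prod_encode (x, m)) k"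
    by (auto elim: eval_MuE)
  have "\<not> n < z" using b[of n] ev_Mu.IH(1) by fastforce
  moreover have "\<not> z < n" using a ev_Mu.IH(2) by fastforce
  ultimately show ?case by simp
next
  case (ev_Rec0 p x y q)
  from ev_Rec0.prems have "eval f p x z" by (rule eval_RecE) auto
  with ev_Rec0.IH show ?case by blast
next
  case (ev_RecS p q x n y w)
  from ev_RecS.prems obtain y' where "eval f (Rec p q) (prod_encode (x, n)) y'"
     "eval f q (prod_encode (prod_encode (x, n), y')) z" by (rule eval_RecE) auto
  with ev_RecS.IH show ?case by blast
next
  case (ev_Comp q x y p z w)
  from ev_Comp.prems ev_Comp.IH show ?case by (metis eval_CompE)
next
  case (ev_Pair p x y q z w)
  from ev_Pair.prems ev_Pair.IH show ?case by (metis eval_PairE)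
qed (auto elim: eval_ZE eval_SE eval_IdE eval_FstE eval_SndE eval_OrcE)

text \<open>Replacing every oracle call by a program that computes the oracle yields transitivity of
  relative computability.\<close>

fun osubst :: "rf \<Rightarrow> rf \<Rightarrow> rf" where
  "osubst r Orc = r"
| "osubst r (Comp p q) = Comp (osubst r p) (osubst r q)"
| "osubst r (Pair p q) = Pair (osubst r p) (osubst r q)"
| "osubst r (Rec p q) = Rec (osubst r p) (osubst r q)"
| "osubst r (Mu p) = Mu (osubst r p)"
| "osubst r p = p"

lemma eval_osubst:
  assumes "\<And>x. eval f r x (g x)"
  shows "eval g p x y \<Longrightarrow> eval f (osubst r p) x y"
proof (induction rule: eval.induct)
  case (ev_Mu p x n)
  then show ?case by (auto intro!: eval.ev_Mu)
qed (auto intro: eval.intros assms)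

lemma computes_trans: "computes g h \<Longrightarrow> computes f g \<Longrightarrow> computes f h"
  unfolding computes_def by (metis eval_osubst)

lemma decides_trans: "decides g P \<Longrightarrow> computes f g \<Longrightarrow> decides f P"
  unfolding decides_def by (rule computes_trans)

lemma decides_from_computable: "decides (chi {}) P \<Longrightarrow> decides f P"
  by (erule decides_trans) (simp add: chi_def[abs_def] computes_const)

section \<open>The jump decides existential predicates\<close>

text \<open>The last decimal digit of a code identifies the outermost constructor. Hence a member of
  a jump is the code of exactly one program.\<close>

lemma code_inj: "code p = code q \<Longrightarrow> p = q"
proof (induction p arbitrary: q)
  case Z show ?case using Z by (cases q; simp; presburger?) next
  case S show ?case using S by (cases q; simp; presburger?) next
  case Ident show ?case using Ident by (cases q; simp; presburger?) next
  case Fst show ?case using Fst by (cases q; simp; presburger?) next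
  case Snd show ?case using Snd by (cases q; simp; presburger?) next
  case Orc show ?case using Orc by (cases q; simp; presburger?) next
  case (Comp p1 p2) show ?case using Comp.prems
    by (cases q; simp; (presburger | use Comp.IH in blast)?) next
  case (Pair p1 p2) show ?case using Pair.prems
    by (cases q; simp; (presburger | use Pair.IH in blast)?) next
  case (Rec p1 p2) show ?case using Rec.prems
    by (cases q; simp; (presburger | use Rec.IH in blast)?) next
  case (Mu p) show ?case using Mu.prems
    by (cases q; simp; (presburger | use Mu.IH in blast)?)
qed

primrec numeral_prog :: "nat \<Rightarrow> rf" where
  "numeral_prog 0 = Z"
| "numeral_prog (Suc n) = Comp S (numeral_prog n)"

lemma eval_numeral_prog: "eval f (numeral_prog n) x n"
  by (induction n) (auto intro: eval.intros)

lemma computes_code_numeral_prog: "computes f (\<lambda>x. code (numeral_prog x))"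
proof -
  \<comment> \<open>Since \<open>code S = 1\<close>, the step \<open>10 * ppair 1 r + 6\<close> is
    the code of \<open>Comp S\<close> applied to the program coded by \<open>r\<close>.\<close>
  have "code (numeral_prog x) = rec_nat 0 (\<lambda>i r. 10 * ppair 1 r + 6) x" for x
    by (induction x) (auto simp: ppair_def)
  then show ?thesis by (simp only:) (intro computability)
qed

text \<open>For each \<open>x\<close> the program \<open>Comp (Mu p) (numeral_prog x)\<close>
  ignores its input and searches for a witness \<open>y\<close>. It halts on its own code exactly if
  a witness exists, and its code is computable from \<open>x\<close>, so one query to the jump
  suffices.\<close>

lemma decides_jump_ex:
  assumes "decides (chi X) (\<lambda>z. R (pfst z) (psnd z))"
  shows "decides (chi (jump X)) (\<lambda>x. \<exists>y. R x y)"
proof -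
  have "decides (chi X) (\<lambda>z. \<not> R (pfst z) (psnd z))" by (intro computability assms)
  then obtain p where p: "\<And>z. eval (chi X) p z (if \<not> R (pfst z) (psnd z) then 1 else 0)"
    unfolding decides_def computes_def by blast
  have p': "eval (chi X) p (prod_encode (x, n)) (if R x n then 0 else 1)" for x n
    using p[of "ppair x n"] by (cases "R x n") (simp_all, simp_all add: ppair_def)
  have halt: "(\<exists>n. eval (chi X) (Mu p) x n) \<longleftrightarrow> (\<exists>n. R x n)" for x
  proof
    assume "\<exists>n. eval (chi X) (Mu p) x n"
    then obtain n where "eval (chi X) p (prod_encode (x, n)) 0" by (auto elim: eval_MuE)
    from eval_det[OF p'[of x n] this] have "R x n" by (simp split: if_splits)
    then show "\<exists>n. R x n" ..
  next
    assume ex: "\<exists>n. R x n"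
    have "eval (chi X) (Mu p) x (LEAST n. R x n)"
    proof (rule ev_Mu)
      show "eval (chi X) p (prod_encode (x, LEAST n. R x n)) 0"
        using p'[of x "LEAST n. R x n"] LeastI_ex[OF ex] by simp
      show "\<forall>m<LEAST n. R x n. \<exists>k>0. eval (chi X) p (prod_encode (x, m)) k"
        using p'[of x] not_less_Least[of _ "R x"] by (metis zero_less_one)
    qed
    then show "\<exists>n. eval (chi X) (Mu p) x n" ..
  qed
  let ?q = "\<lambda>x. Comp (Mu p) (numeral_prog x)"
  have "code (?q x) \<in> jump X \<longleftrightarrow> (\<exists>n. R x n)" for x
  proof -
    have "code (?q x) \<in> jump X \<longleftrightarrow> (\<exists>y. eval (chi X) (?q x) (code (?q x)) y)"
      unfolding jump_def using code_inj by blast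
    also have "\<dots> \<longleftrightarrow> (\<exists>y. eval (chi X) (Mu p) x y)"
      by (metis ev_Comp eval_CompE eval_det eval_numeral_prog)
    finally show ?thesis using halt by simp
  qed
  moreover have "decides (chi (jump X)) (\<lambda>x. code (?q x) \<in> jump X)"
  proof -
    have "computes (chi (jump X)) (\<lambda>x. 10 * ppair (code (Mu p)) (code (numeral_prog x)) + 6)"
      by (intro computability computes_code_numeral_prog)
    then have "computes (chi (jump X)) (\<lambda>x. code (?q x))" by (simp add: ppair_def)
    from decides_eq[OF computes_oracle[OF this] computes_const[of _ 1]]
    show ?thesis by (rule decides_cong) (simp add: chi_def)
  qed
  ultimately show ?thesis by simp
qed

lemma decides_chi [computability]: assumes "computes (chi X) g" shows "decides (chi X) (\<lambda>x. g x \<in> X)"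
  using computes_oracle[OF assms] by (simp add: decides_def chi_def)

lemma decides_jump_all:
  assumes "decides (chi X) (\<lambda>z. R (pfst z) (psnd z))"
  shows "decides (chi (jump X)) (\<lambda>x. \<forall>y. R x y)"
proof -
  have "decides (chi X) (\<lambda>z. \<not> R (pfst z) (psnd z))" by (intro computability assms)
  from decides_not[OF decides_jump_ex[OF this]] show ?thesis by simp
qed

section \<open>Stagewise enumeration of computations\<close>

lemma decides_set_decode [computability]:
  assumes "computes f g" "computes f n" shows "decides f (\<lambda>x. g x \<in> set_decode (n x))"
  unfolding set_decode_def mem_Collect_eq by (intro computability assms)

section \<open>Finite stages of a monotone operator\<close>

lemma less_of_set_decode: "t \<in> set_decode c \<Longrightarrow> t < c"
  by (metis Suc_leI div_less dvd_0_right le_less_trans less_exp linorder_not_less mem_Collect_eq set_decode_def)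

text \<open>The cutoff \<open>t < Suc s\<close> keeps every stage finite, hence codable by one
  number; a larger fact merely enters later.\<close>

primrec stage :: "(nat set \<Rightarrow> nat \<Rightarrow> bool) \<Rightarrow> nat \<Rightarrow> nat set" where
  "stage J 0 = {}"
| "stage J (Suc s) = {t. t < Suc s \<and> J (stage J s) t}"

lemma stage_less: "t \<in> stage J s \<Longrightarrow> t < s"
  by (cases s) auto

lemma finite_stage: "finite (stage J s)"
  by (rule finite_subset[of _ "{..<s}"]) (auto dest: stage_less)

lemma stage_mono:
  assumes "mono J" "s \<le> s'" shows "stage J s \<subseteq> stage J s'"
proof -
  have "stage J s \<subseteq> stage J (Suc s)" for s
  proof (induction s)
    case (Suc s)
    from monoD[OF assms(1) this] have "J (stage J s) \<le> J (stage J (Suc s))" .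
    then show ?case by (auto simp: le_fun_def simp del: stage.simps(1))
  qed simp
  then show ?thesis using assms(2) by (rule lift_Suc_mono_le)
qed

text \<open>A derivable \<open>t\<close> may lie beyond the current cutoff. At stage
  \<open>max s t\<close> the cutoff no longer matters, and monotonicity preserves the
  derivation.\<close>

lemma stageI:
  assumes "mono J" "J (stage J s) t" shows "\<exists>s'. t \<in> stage J s'"
proof -
  have "J (stage J (max s t)) t"
    using assms monoD[OF assms(1) stage_mono[OF assms(1), of s "max s t"]] by (auto simp: le_fun_def)
  then have "t \<in> stage J (Suc (max s t))" by simp
  then show ?thesis ..
qed

text \<open>The parameter \<open>u\<close> lets the operator vary with the input, as it must when
  the oracle is itself an approximation that depends on the input.\<close>

lemma decides_stage:
  assumes J: "decides f (\<lambda>z. J (pfst z) (set_decode (pfst (psnd z))) (psnd (psnd z)))"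
    and "computes f u" "computes f s" "computes f t"
  shows "decides f (\<lambda>x. t x \<in> stage (J (u x)) (s x))"
proof -
  have J': "decides f (\<lambda>x. J (a x) (set_decode (b x)) (c x))" if "computes f a" "computes f b" "computes f c" for a b c
    using decides_comp[OF J, of "\<lambda>x. ppair (a x) (ppair (b x) (c x))"] that by (simp add: computes_ppair)
  \<comment> \<open>The recursion carries the whole stage, as the binary code of a finite
    set.\<close>
  let ?c = "\<lambda>u s. rec_nat 0 (\<lambda>s c. \<Sum>t<Suc s. if J u (set_decode c) t then 2 ^ t else 0) s"
  have c: "?c u s = set_encode (stage (J u) s)" for u s
  proof (induction s)
    case 0 show ?case by (simp add: set_encode_def)
  next
    case (Suc s)
    have "?c u (Suc s) = (\<Sum>t<Suc s. if J u (stage (J u) s) t then 2 ^ t else 0)"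
      using Suc.IH by (simp add: set_encode_inverse finite_stage del: sum.lessThan_Suc)
    also have "\<dots> = (\<Sum>t\<in>{t \<in> {..<Suc s}. J u (stage (J u) s) t}. 2 ^ t)"
      by (simp only: sum.inter_filter finite_lessThan)
    finally show ?case by (simp add: set_encode_def)
  qed
  have "decides f (\<lambda>x. t x \<in> set_decode (?c (u x) (s x)))"
    by (intro computability J' assms computes_comp[OF assms(2)])
  then show ?thesis unfolding c by (simp add: set_encode_inverse finite_stage)
qed

section \<open>Enumerating program codes and evaluations\<close>

text \<open>Being a program code is enumerated separately because an evaluation need not visit every
  subprogram: a \<open>Rec\<close> at 0 never runs its step program, so numbers that code no program
  can also produce values under \<open>eval_step\<close>.\<close>

definition code_step :: "nat set \<Rightarrow> nat \<Rightarrow> bool" where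
  "code_step A e \<longleftrightarrow> e \<le> 5 \<or>
     (e mod 10 = 6 \<or> e mod 10 = 7 \<or> e mod 10 = 8) \<and> pfst (e div 10) \<in> A \<and> psnd (e div 10) \<in> A \<or>
     e mod 10 = 9 \<and> e div 10 \<in> A"

text \<open>Codes the fact that program \<open>e\<close> sends \<open>x\<close> to
  \<open>y\<close>.\<close>

definition triple :: "nat \<Rightarrow> nat \<Rightarrow> nat \<Rightarrow> nat" where
  "triple e x y = ppair e (ppair x y)"

text \<open>Each disjunct mirrors one rule of \<open>eval\<close>, with oracle \<open>h\<close> and
  with premises taken from \<open>A\<close>. Every existential starts with a membership of a triple
  ending in the bound variable, so that it can be bounded once \<open>A\<close> is a coded finite
  set.\<close>

definition eval_step :: "(nat \<Rightarrow> nat) \<Rightarrow> nat set \<Rightarrow> nat \<Rightarrow> bool" where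
  "eval_step h A t \<longleftrightarrow> (let e = pfst t; x = pfst (psnd t); y = psnd (psnd t); d = e div 10 in
     e = 0 \<and> y = 0 \<or> e = 1 \<and> y = Suc x \<or> e = 2 \<and> y = x \<or> e = 3 \<and> y = pfst x \<or>
     e = 4 \<and> y = psnd x \<or> e = 5 \<and> y = h x \<or>
     e mod 10 = 6 \<and> (\<exists>z. triple (psnd d) x z \<in> A \<and> triple (pfst d) z y \<in> A) \<or>
     e mod 10 = 7 \<and> triple (pfst d) x (pfst y) \<in> A \<and> triple (psnd d) x (psnd y) \<in> A \<or>
     e mod 10 = 8 \<and> psnd x = 0 \<and> triple (pfst d) (pfst x) y \<in> A \<or>
     e mod 10 = 8 \<and> 0 < psnd x \<and> (\<exists>z. triple e (ppair (pfst x) (psnd x - 1)) z \<in> A \<and>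
        triple (psnd d) (ppair (ppair (pfst x) (psnd x - 1)) z) y \<in> A) \<or>
     e mod 10 = 9 \<and> triple d (ppair x y) 0 \<in> A \<and> (\<forall>m<y. \<exists>k. triple d (ppair x m) k \<in> A \<and> 0 < k))"

lemma mono_code_step: "mono code_step"
  by (rule monoI) (auto simp: code_step_def le_fun_def)

lemma mono_eval_step: "mono (eval_step h)"
proof (rule monoI, rule le_funI, rule le_boolI)
  fix A B t assume AB: "A \<subseteq> B" and "eval_step h A t"
  have "eval_step h A t \<longrightarrow> eval_step h B t" unfolding eval_step_def Let_def
    by (intro disj_mono conj_mono ex_mono all_mono imp_mono imp_refl in_mono[OF AB])
  then show "eval_step h B t" using \<open>eval_step h A t\<close> ..
qed

lemma triple_less: "triple e x y \<in> set_decode c \<Longrightarrow> y < c"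
  using less_of_set_decode[of "triple e x y" c] le_ppair2[of y x] le_ppair2[of "ppair x y" e]
  unfolding triple_def by linarith

text \<open>Members of the set coded by \<open>c\<close> are below \<open>c\<close>, so the
  quantifiers of \<open>eval_step\<close> become bounded searches.\<close>

lemma ex_triple_bounded:
  "(\<exists>y. triple e x y \<in> set_decode c \<and> Q y) \<longleftrightarrow> (\<exists>y<c. triple e x y \<in> set_decode c \<and> Q y)"
  using triple_less by blast

lemma computes_triple [computability]: "computes f a \<Longrightarrow> computes f b \<Longrightarrow> computes f c \<Longrightarrow> computes f (\<lambda>x. triple (a x) (b x) (c x))"
  unfolding triple_def by (intro computability)

lemma decides_code_stage [computability]: "computes f s \<Longrightarrow> computes f t \<Longrightarrow> decides f (\<lambda>x. t x \<in> stage code_step (s x))"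
proof (rule decides_stage[of f "\<lambda>u. code_step" "\<lambda>x. 0"])
  show "decides f (\<lambda>z. code_step (set_decode (pfst (psnd z))) (psnd (psnd z)))"
    unfolding code_step_def by (intro computability)
qed (simp_all add: computes_const)

lemma decides_eval_stage:
  assumes "computes f (\<lambda>z. h (pfst z) (psnd z))" "computes f u" "computes f s" "computes f t"
  shows "decides f (\<lambda>x. t x \<in> stage (eval_step (h (u x))) (s x))"
proof (rule decides_stage[of f "\<lambda>u. eval_step (h u)", OF _ assms(2-)])
  show "decides f (\<lambda>z. eval_step (h (pfst z)) (set_decode (pfst (psnd z))) (psnd (psnd z)))"
    unfolding eval_step_def Let_def ex_triple_bounded by (intro computability computes2[OF assms(1)])
qed

text \<open>Use principle: facts derived up to stage \<open>s\<close> are numbers below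
  \<open>s\<close>, and the argument of an oracle query is a component of such a number.\<close>

lemma eval_stage_cong:
  assumes "\<And>x. x < s \<Longrightarrow> h x = g x" shows "stage (eval_step h) s = stage (eval_step g) s"
  using assms
proof (induction s)
  case (Suc s)
  have hg: "h (pfst (psnd t)) = g (pfst (psnd t))" if "t < Suc s" for t
    using that le_ppair1[of "pfst (psnd t)" "psnd (psnd t)"] le_ppair2[of "psnd t" "pfst t"]
    by (intro Suc.prems) simp
  have "eval_step h A t = eval_step g A t" if "t < Suc s" for t A
    by (simp only: eval_step_def Let_def hg[OF that])
  moreover have "stage (eval_step h) s = stage (eval_step g) s"
    by (rule Suc.IH) (simp add: Suc.prems)
  ultimately show ?case by (simp cong: conj_cong)
qed simp

lemma eval_stage_sound:
  "t \<in> stage (eval_step h) s \<Longrightarrow> code p = pfst t \<Longrightarrow> eval h p (pfst (psnd t)) (psnd (psnd t))"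
proof (induction s arbitrary: t p)
  case (Suc s)
  define x y where "x = pfst (psnd t)" and "y = psnd (psnd t)"
  have IH: "eval h q a b" if "triple (code q) a b \<in> stage (eval_step h) s" for q a b
    using Suc.IH[OF that, of q] by (simp add: triple_def)
  have st: "eval_step h (stage (eval_step h) s) t" using Suc.prems(1) by simp
  have pfst_enc [simp]: "pfst (prod_encode (a, b)) = a" "psnd (prod_encode (a, b)) = b" for a b
    by (simp_all add: pfst_def psnd_def)
  have "eval h p x y"
  proof (cases p)
    case Z
    then show ?thesis using st Suc.prems(2)[symmetric] ev_Z
      by (auto simp: eval_step_def x_def y_def)
  next
    case S
    then show ?thesis using st Suc.prems(2)[symmetric] ev_S
      by (auto simp: eval_step_def x_def y_def)
  next
    case Ident
    then show ?thesis using st Suc.prems(2)[symmetric] ev_Id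
      by (auto simp: eval_step_def x_def y_def)
  next
    case Fst
    then show ?thesis using st Suc.prems(2)[symmetric] ev_Fst[of h x]
      by (auto simp: eval_step_def x_def y_def pfst_def)
  next
    case Snd
    then show ?thesis using st Suc.prems(2)[symmetric] ev_Snd[of h x]
      by (auto simp: eval_step_def x_def y_def psnd_def)
  next
    case Orc
    then show ?thesis using st Suc.prems(2)[symmetric] ev_Orc
      by (auto simp: eval_step_def x_def y_def)
  next
    case (Comp p1 p2)
    then have c: "pfst t = 10 * prod_encode (code p1, code p2) + 6" using Suc.prems(2) by simp
    then have "pfst t mod 10 = 6" "pfst t div 10 = prod_encode (code p1, code p2)" by presburger+
    with st c obtain z where "triple (code p2) x z \<in> stage (eval_step h) s" "triple (code p1) z y \<in> stage (eval_step h) s"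
      by (auto simp: eval_step_def Let_def x_def y_def)
    with IH show ?thesis unfolding Comp by (blast intro: ev_Comp)
  next
    case (Pair p1 p2)
    then have c: "pfst t = 10 * prod_encode (code p1, code p2) + 7" using Suc.prems(2) by simp
    then have "pfst t mod 10 = 7" "pfst t div 10 = prod_encode (code p1, code p2)" by presburger+
    with st c have "triple (code p1) x (pfst y) \<in> stage (eval_step h) s" "triple (code p2) x (psnd y) \<in> stage (eval_step h) s"
      by (auto simp: eval_step_def Let_def x_def y_def)
    with IH have "eval h (Pair p1 p2) x (prod_encode (pfst y, psnd y))" by (blast intro: ev_Pair)
    then show ?thesis using Pair by (simp add: ppair_def[symmetric])
  next
    case (Rec p1 p2)
    then have c: "pfst t = 10 * prod_encode (code p1, code p2) + 8" using Suc.prems(2) by simp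
    then have m: "pfst t mod 10 = 8" "pfst t div 10 = prod_encode (code p1, code p2)" by presburger+
    show ?thesis
    proof (cases "psnd x")
      case 0
      with st c m have "triple (code p1) (pfst x) y \<in> stage (eval_step h) s"
        by (auto simp: eval_step_def Let_def x_def y_def)
      with IH have "eval h (Rec p1 p2) (prod_encode (pfst x, 0)) y" by (blast intro: ev_Rec0)
      then show ?thesis using Rec 0 ppair_pfst_psnd[of x] by (simp add: ppair_def)
    next
      case (Suc n)
      with st c m obtain z where "triple (code p) (ppair (pfst x) n) z \<in> stage (eval_step h) s"
         "triple (code p2) (ppair (ppair (pfst x) n) z) y \<in> stage (eval_step h) s"
        using \<open>code p = pfst t\<close> by (auto simp: eval_step_def Let_def x_def y_def)
      with IH have "eval h (Rec p1 p2) (prod_encode (pfst x, n)) z"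
         "eval h p2 (prod_encode (prod_encode (pfst x, n), z)) y" using Rec by (auto simp: ppair_def)
      then have "eval h (Rec p1 p2) (prod_encode (pfst x, Suc n)) y" by (rule ev_RecS)
      then show ?thesis using Rec Suc ppair_pfst_psnd[of x] by (simp add: ppair_def)
    qed
  next
    case (Mu q)
    then have c: "pfst t = 10 * code q + 9" using Suc.prems(2) by simp
    then have "pfst t mod 10 = 9" "pfst t div 10 = code q" by presburger+
    with st c have "triple (code q) (ppair x y) 0 \<in> stage (eval_step h) s"
      "\<forall>m<y. \<exists>k. triple (code q) (ppair x m) k \<in> stage (eval_step h) s \<and> 0 < k"
      by (auto simp: eval_step_def Let_def x_def y_def)
    with IH show ?thesis unfolding Mu ppair_def by (blast intro: ev_Mu)
  qed
  then show ?case by (simp add: x_def y_def)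
qed simp

lemma common_bound:
  fixes P :: "nat \<Rightarrow> nat \<Rightarrow> bool"
  assumes "\<And>m s s'. P m s \<Longrightarrow> s \<le> s' \<Longrightarrow> P m s'" "\<forall>m<n. \<exists>s. P m s"
  shows "\<exists>s. \<forall>m<n. P m s"
  using assms(2)
proof (induction n)
  case (Suc n)
  then obtain s s' where "\<forall>m<n. P m s" "P n s'" by fastforce
  then have "\<forall>m<Suc n. P m (max s s')" using assms(1) less_Suc_eq by (metis max.cobounded1 max.cobounded2)
  then show ?case ..
qed simp

lemma stage_max:
  assumes "mono J" "a \<in> stage J s" "b \<in> stage J s'"
  obtains u where "a \<in> stage J u" "b \<in> stage J u"
  using assms stage_mono[OF assms(1)] by (metis max.cobounded1 max.cobounded2 subsetD)

lemma eval_stage_complete: "eval h p x y \<Longrightarrow> \<exists>s. triple (code p) x y \<in> stage (eval_step h) s"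
proof (induction rule: eval.induct)
  case (ev_Comp q x y p z)
  then obtain u where u: "triple (code q) x y \<in> stage (eval_step h) u" "triple (code p) y z \<in> stage (eval_step h) u"
    using stage_max[OF mono_eval_step] by blast
  have "code (Comp p q) mod 10 = 6" "code (Comp p q) div 10 = ppair (code p) (code q)"
    unfolding code.simps ppair_def by presburger+
  then show ?case using u
    by (intro stageI[OF mono_eval_step, of _ u])
       (auto simp: eval_step_def Let_def triple_def simp del: code.simps)
next
  case (ev_Pair p x y q z)
  then obtain u where u: "triple (code p) x y \<in> stage (eval_step h) u" "triple (code q) x z \<in> stage (eval_step h) u"
    using stage_max[OF mono_eval_step] by blast
  have "code (Pair p q) mod 10 = 7" "code (Pair p q) div 10 = ppair (code p) (code q)"
    unfolding code.simps ppair_def by presburger+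
  then show ?case using u unfolding ppair_def[of y z, symmetric]
    by (intro stageI[OF mono_eval_step, of _ u])
       (auto simp: eval_step_def Let_def triple_def simp del: code.simps)
next
  case (ev_Rec0 p x y q)
  then obtain u where u: "triple (code p) x y \<in> stage (eval_step h) u" by blast
  have "code (Rec p q) mod 10 = 8" "code (Rec p q) div 10 = ppair (code p) (code q)"
    unfolding code.simps ppair_def by presburger+
  then show ?case using u unfolding ppair_def[of _ 0, symmetric]
    by (intro stageI[OF mono_eval_step, of _ u])
       (auto simp: eval_step_def Let_def triple_def simp del: code.simps)
next
  case (ev_RecS p q x n y z)
  then obtain u where u: "triple (code (Rec p q)) (ppair x n) y \<in> stage (eval_step h) u"
     "triple (code q) (ppair (ppair x n) y) z \<in> stage (eval_step h) u"
    using stage_max[OF mono_eval_step] unfolding ppair_def by blast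
  have "code (Rec p q) mod 10 = 8" "code (Rec p q) div 10 = ppair (code p) (code q)"
    unfolding code.simps ppair_def by presburger+
  then show ?case using u unfolding ppair_def[of _ "Suc _", symmetric]
    by (intro stageI[OF mono_eval_step, of _ u])
       (auto simp: eval_step_def Let_def triple_def simp del: code.simps)
next
  case (ev_Mu p x n)
  let ?P = "\<lambda>m s. \<exists>k. triple (code p) (ppair x m) k \<in> stage (eval_step h) s \<and> 0 < k"
  \<comment> \<open>The finitely many values below \<open>n\<close> may appear at different stages;
    monotonicity provides a common one.\<close>
  have "\<forall>m<n. \<exists>s. ?P m s" using ev_Mu.IH(2) unfolding ppair_def by blast
  then obtain s where s: "\<forall>m<n. ?P m s"
    using common_bound[of ?P n] stage_mono[OF mono_eval_step] by blast
  obtain s' where s': "triple (code p) (ppair x n) 0 \<in> stage (eval_step h) s'"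
    using ev_Mu.IH(1) unfolding ppair_def by blast
  define u where "u = max s s'"
  have "s \<le> u" "s' \<le> u" by (auto simp: u_def)
  then have u: "\<forall>m<n. ?P m u" "triple (code p) (ppair x n) 0 \<in> stage (eval_step h) u"
    using s s' stage_mono[OF mono_eval_step] by blast+
  have "code (Mu p) mod 10 = 9" "code (Mu p) div 10 = code p"
    unfolding code.simps by presburger+
  then show ?case using u
    by (intro stageI[OF mono_eval_step, of _ u])
       (auto simp: eval_step_def Let_def triple_def simp del: code.simps)
qed (rule stageI[OF mono_eval_step, of _ 0]; simp add: eval_step_def Let_def triple_def pfst_def psnd_def ppair_def; fail)+

lemma stage_code_sound: "e \<in> stage code_step s \<Longrightarrow> \<exists>p. e = code p"
proof (induction s arbitrary: e)
  case (Suc s)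
  from Suc.prems have "code_step (stage code_step s) e" by simp
  then consider "e \<le> 5"
    | p q where "e mod 10 = 6 \<or> e mod 10 = 7 \<or> e mod 10 = 8" "pfst (e div 10) = code p" "psnd (e div 10) = code q"
    | p where "e mod 10 = 9" "e div 10 = code p"
    unfolding code_step_def[of "stage code_step s"] using Suc.IH by blast
  then show ?case
  proof cases
    case 1
    then consider "e = 0" | "e = 1" | "e = 2" | "e = 3" | "e = 4" | "e = 5" by linarith
    then show ?thesis
      by cases (metis code.simps(1), metis code.simps(2), metis code.simps(3), metis code.simps(4),
          metis code.simps(5), metis code.simps(6))
  next
    case 2
    have e: "e = 10 * prod_encode (code p, code q) + e mod 10"
      using ppair_pfst_psnd[of "e div 10"] 2 by (simp add: ppair_def)
    then show ?thesis using 2(1) by (metis code.simps(7) code.simps(8) code.simps(9))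
  next
    case 3
    then have "e = code (Mu p)" using div_mult_mod_eq[of e 10] by simp
    then show ?thesis ..
  qed
qed simp

lemma stage_code_complete: "\<exists>s. code p \<in> stage code_step s"
proof -
  have J: "\<exists>s. code p \<in> stage code_step s" if "code_step (stage code_step s) (code p)" for s p
    using stageI[OF mono_code_step that] .
  have two: "\<exists>s. code r \<in> stage code_step s" if r: "\<exists>s. code p \<in> stage code_step s" "\<exists>s. code q \<in> stage code_step s"
    "code r mod 10 = 6 \<or> code r mod 10 = 7 \<or> code r mod 10 = 8" "code r div 10 = ppair (code p) (code q)" for p q r
  proof -
    obtain u where "code p \<in> stage code_step u" "code q \<in> stage code_step u"
      using r(1,2) stage_max[OF mono_code_step] by blast
    with r(3,4) show ?thesis by (intro J[of u]) (simp add: code_step_def)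
  qed
  show ?thesis
  proof (induction p)
    case (Comp p q)
    then show ?case by (rule two) (unfold code.simps ppair_def, presburger+)
  next
    case (Pair p q)
    then show ?case by (rule two) (unfold code.simps ppair_def, presburger+)
  next
    case (Rec p q)
    then show ?case by (rule two) (unfold code.simps ppair_def, presburger+)
  next
    case (Mu p)
    then obtain s where "code p \<in> stage code_step s" ..
    moreover have "code (Mu p) mod 10 = 9" "code (Mu p) div 10 = code p" unfolding code.simps by presburger+
    ultimately show ?case by (intro J[of s]) (simp add: code_step_def)
  qed (rule J[of 0]; simp add: code_step_def)+
qed

section \<open>Approximating the jump\<close>

text \<open>The bound \<open>y < u\<close> makes the stage decidable and loses nothing: a triple in
  stage \<open>u\<close> is below \<open>u\<close>, and so is its last component.\<close>

definition jump_stage :: "(nat \<Rightarrow> nat) \<Rightarrow> nat \<Rightarrow> nat set" where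
  "jump_stage h u = {e. e \<in> stage code_step u \<and> (\<exists>y<u. triple e e y \<in> stage (eval_step h) u)}"

lemma jump_stage_mono: "s \<le> s' \<Longrightarrow> jump_stage h s \<subseteq> jump_stage h s'"
  unfolding jump_stage_def
  using stage_mono[OF mono_code_step, of s s'] stage_mono[OF mono_eval_step, of s s' h]
  by (auto 4 4 dest: less_le_trans)

lemma jump_iff_stage: "e \<in> jump X \<longleftrightarrow> (\<exists>u. e \<in> jump_stage (chi X) u)"
proof
  assume "e \<in> jump X"
  then obtain p y where e: "e = code p" and "eval (chi X) p (code p) y" by (auto simp: jump_def)
  then obtain s where s: "triple e e y \<in> stage (eval_step (chi X)) s" using eval_stage_complete by blast
  obtain s' where s': "e \<in> stage code_step s'" using stage_code_complete e by blast
  define u where "u = max s s'"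
  have "s \<le> u" "s' \<le> u" by (auto simp: u_def)
  then have u: "triple e e y \<in> stage (eval_step (chi X)) u" "e \<in> stage code_step u"
    using s s' stage_mono[OF mono_eval_step] stage_mono[OF mono_code_step] by blast+
  moreover have "y < u" using stage_less[OF u(1)] le_ppair2[of "ppair e y" e] le_ppair2[of y e]
    by (simp add: triple_def)
  ultimately show "\<exists>u. e \<in> jump_stage (chi X) u" by (auto simp: jump_stage_def)
next
  assume "\<exists>u. e \<in> jump_stage (chi X) u"
  then obtain u y where "e \<in> stage code_step u" and t: "triple e e y \<in> stage (eval_step (chi X)) u"
    by (auto simp: jump_stage_def)
  then obtain p where "e = code p" using stage_code_sound by blast
  with eval_stage_sound[OF t, of p] show "e \<in> jump X" by (auto simp: jump_def triple_def)
qed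

lemma decides_jump_stage:
  assumes "computes f h" "computes f e" "computes f s" shows "decides f (\<lambda>x. e x \<in> jump_stage h (s x))"
  unfolding jump_stage_def mem_Collect_eq
  by (intro computability assms decides_eval_stage[of f "\<lambda>_. h" "\<lambda>_. 0"] computes_comp[OF assms(1)] computes_comp[OF assms(2)]
      computes_comp[OF assms(3)])

text \<open>Only finitely many elements below \<open>s\<close> ever enter the jump, so the
  approximation settles on every initial segment.\<close>

lemma jump_stage_limit: "\<exists>t0. \<forall>u\<ge>t0. \<forall>x<s. chi (jump_stage (chi X) u) x = chi (jump X) x"
proof -
  have "\<exists>t0. \<forall>x<s. x \<in> jump X \<longrightarrow> x \<in> jump_stage (chi X) t0"
    by (rule common_bound) (use jump_stage_mono in blast, use jump_iff_stage in blast)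
  then obtain t0 where t0: "\<forall>x<s. x \<in> jump X \<longrightarrow> x \<in> jump_stage (chi X) t0" ..
  then have "\<forall>u\<ge>t0. \<forall>x<s. x \<in> jump_stage (chi X) u \<longleftrightarrow> x \<in> jump X"
    using jump_stage_mono jump_iff_stage by blast
  then show ?thesis unfolding chi_def by (intro exI[of _ t0]) simp
qed

text \<open>A negative answer computed from the jump is certified by a computation of some bounded
  size \<open>t\<close> that survives under all later approximations to the oracle.\<close>
lemma decides_jump_Pi2:
  assumes "decides (chi (jump X)) P"
  obtains Q where "decides (chi X) (\<lambda>z. Q (pfst z) (pfst (psnd z)) (psnd (psnd z)))" "\<And>x. P x \<longleftrightarrow> (\<forall>a. \<exists>b. Q x a b)"
proof -
  from assms obtain p where p: "\<And>x. eval (chi (jump X)) p x (if P x then 1 else 0)"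
    unfolding decides_def computes_def by blast
  define K where "K u = chi (jump_stage (chi X) u)" for u
  define Q where "Q x t u \<longleftrightarrow> t \<le> u \<and> triple (code p) x 0 \<notin> stage (eval_step (K u)) t" for x t u
  have "computes (chi X) (\<lambda>z. K (pfst z) (psnd z))" unfolding K_def chi_def[of "jump_stage _ _"]
    by (intro computability decides_jump_stage computes_oracle[OF computes_id])
  then have "decides (chi X) (\<lambda>z. Q (pfst z) (pfst (psnd z)) (psnd (psnd z)))"
    unfolding Q_def by (intro computability decides_eval_stage)
  moreover have "P x \<longleftrightarrow> (\<forall>t. \<exists>u. Q x t u)" for x
  proof (rule iffI, rule allI)
    fix t assume "P x"
    obtain t0 where "\<forall>u\<ge>t0. \<forall>x<t. K u x = chi (jump X) x" using jump_stage_limit K_def by metis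
    then have "stage (eval_step (K (max t t0))) t = stage (eval_step (chi (jump X))) t"
      by (intro eval_stage_cong) auto
    moreover have "triple (code p) x 0 \<notin> stage (eval_step (chi (jump X))) t"
      using eval_stage_sound[of "triple (code p) x 0" "chi (jump X)" t p] eval_det[OF p[of x], of 0] \<open>P x\<close>
      by (auto simp: triple_def)
    ultimately have "Q x t (max t t0)" by (simp add: Q_def)
    then show "\<exists>u. Q x t u" ..
  next
    assume Q: "\<forall>t. \<exists>u. Q x t u"
    show "P x"
    proof (rule ccontr)
      assume "\<not> P x"
      then have "eval (chi (jump X)) p x 0" using p[of x] by simp
      then obtain s where s: "triple (code p) x 0 \<in> stage (eval_step (chi (jump X))) s"
        using eval_stage_complete by blast
      obtain t0 where t0: "\<forall>u\<ge>t0. \<forall>x<s. K u x = chi (jump X) x" using jump_stage_limit K_def by metis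
      \<comment> \<open>The choice \<open>max s t0\<close> makes the bound large enough to contain
        the computation and, since \<open>Q\<close> forces it to be at most \<open>u\<close>, places
        \<open>u\<close> after the approximation has settled below \<open>s\<close>.\<close>
      obtain u where u: "Q x (max s t0) u" using Q by blast
      then have "stage (eval_step (K u)) s = stage (eval_step (chi (jump X))) s"
        using t0 by (intro eval_stage_cong) (auto simp: Q_def)
      then have "triple (code p) x 0 \<in> stage (eval_step (K u)) (max s t0)"
        using s stage_mono[OF mono_eval_step, of s "max s t0" "K u"] by auto
      then show False using u by (simp add: Q_def)
    qed
  qed
  ultimately show ?thesis using that by blast
qed

section \<open>Equivalence structures and their classes\<close>

abbreviation (input) ces :: "nat set \<Rightarrow> (nat \<times> nat) set \<Rightarrow> bool" where
  "ces \<equiv> computable_equiv_structure"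

lemma rel_code_iff: "z \<in> rel_code F \<longleftrightarrow> (pfst z, psnd z) \<in> F"
proof
  assume "(pfst z, psnd z) \<in> F"
  moreover have "z = prod_encode (pfst z, psnd z)" by (simp add: ppair_def[symmetric])
  ultimately show "z \<in> rel_code F" unfolding rel_code_def by blast
qed (auto simp: rel_code_def pfst_def psnd_def)

lemma computable_set_iff: "computable_set X \<longleftrightarrow> decides (chi {}) (\<lambda>x. x \<in> X)"
  by (simp add: computable_set_def turing_le_def set_le_fun_iff)

lemma computable_structure_iff:
  "computable_structure B F \<longleftrightarrow> F \<subseteq> B \<times> B \<and> decides (chi {}) (\<lambda>x. x \<in> B) \<and>
     decides (chi {}) (\<lambda>z. (pfst z, psnd z) \<in> F)"
  by (simp add: computable_structure_def computable_set_iff rel_code_iff)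

lemma ces_equiv: "ces B F \<Longrightarrow> equiv B F"
  by (simp add: computable_equiv_structure_def)

lemma decides_universe: "ces B F \<Longrightarrow> computes f a \<Longrightarrow> decides f (\<lambda>x. a x \<in> B)"
  unfolding computable_equiv_structure_def computable_structure_iff
  using decides_comp decides_from_computable by blast

lemma decides_rel: "ces B F \<Longrightarrow> computes f a \<Longrightarrow> computes f b \<Longrightarrow> decides f (\<lambda>x. (a x, b x) \<in> F)"
  unfolding computable_equiv_structure_def computable_structure_iff
  using decides2[of f "\<lambda>x y. (x, y) \<in> F"] decides_from_computable by blast

text \<open>The disjunct \<open>y = x\<close> makes the search succeed outside the universe too, so
  that the function is total and computable.\<close>

definition class_rep :: "(nat \<times> nat) set \<Rightarrow> nat \<Rightarrow> nat" where
  "class_rep F x = (LEAST y. (y, x) \<in> F \<or> y = x)"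

text \<open>Position of \<open>x\<close> in the increasing enumeration of its class. It is
  computable although the class size is not, and \<open>Suc (idx F x)\<close> is a lower bound for
  that size.\<close>

definition idx :: "(nat \<times> nat) set \<Rightarrow> nat \<Rightarrow> nat" where
  "idx F x = card {y. y < x \<and> (y, x) \<in> F}"

definition classes :: "nat set \<Rightarrow> (nat \<times> nat) set \<Rightarrow> (nat set \<Rightarrow> bool) \<Rightarrow> nat set set" where
  "classes B F Q = {F `` {x} | x. x \<in> B \<and> Q (F `` {x})}"

definition reps :: "nat set \<Rightarrow> (nat \<times> nat) set \<Rightarrow> (nat set \<Rightarrow> bool) \<Rightarrow> nat set" where
  "reps B F Q = {x \<in> B. class_rep F x = x \<and> Q (F `` {x})}"

text \<open>\<open>card\<close> is 0 on infinite sets, so size comparisons here and in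
  \<open>dominates\<close> treat them separately.\<close>

definition card_ge :: "nat \<Rightarrow> nat set \<Rightarrow> bool" where
  "card_ge k M \<longleftrightarrow> infinite M \<or> k \<le> card M"

definition dominates :: "nat set \<Rightarrow> nat set \<Rightarrow> bool" where
  "dominates M N \<longleftrightarrow> infinite M \<or> finite N \<and> card N \<le> card M"

lemma finitely_many_infinite_classes_iff:
  "finitely_many_infinite_classes B F \<longleftrightarrow> finite (classes B F infinite)"
  by (simp add: finitely_many_infinite_classes_def classes_def)

lemma computes_class_rep: assumes "ces B F" "computes f a" shows "computes f (\<lambda>x. class_rep F (a x))"
  unfolding class_rep_def by (intro computability decides_rel[OF assms(1)] computes_comp[OF assms(2)]) blast

lemma computes_idx: assumes "ces B F" "computes f a" shows "computes f (\<lambda>x. idx F (a x))"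
  unfolding idx_def by (intro computability decides_rel[OF assms(1)] computes_comp[OF assms(2)])

lemma equivD:
  assumes "equiv B F"
  shows "x \<in> B \<Longrightarrow> (x, x) \<in> F" "(x, y) \<in> F \<Longrightarrow> (y, x) \<in> F"
    "(x, y) \<in> F \<Longrightarrow> (y, z) \<in> F \<Longrightarrow> (x, z) \<in> F" "(x, y) \<in> F \<Longrightarrow> x \<in> B" "(x, y) \<in> F \<Longrightarrow> y \<in> B"
  using assms by (auto simp: equiv_def refl_on_def dest: symD transD)

lemma class_eq: "equiv B F \<Longrightarrow> (x, y) \<in> F \<Longrightarrow> F `` {x} = F `` {y}"
  by (rule equiv_class_eq)

lemma class_rep_rel:
  assumes "equiv B F" "x \<in> B" shows "(class_rep F x, x) \<in> F"
proof -
  have "\<exists>y. (y, x) \<in> F \<or> y = x" by blast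
  from LeastI_ex[OF this] show ?thesis using equivD(1)[OF assms] by (auto simp: class_rep_def)
qed

lemma class_rep_cong:
  assumes "equiv B F" "(x, y) \<in> F" shows "class_rep F x = class_rep F y"
proof -
  have "(z, x) \<in> F \<or> z = x \<longleftrightarrow> (z, y) \<in> F \<or> z = y" for z
    using assms equivD[OF assms(1)] by metis
  then show ?thesis by (simp add: class_rep_def)
qed

lemma class_rep_idem: "equiv B F \<Longrightarrow> x \<in> B \<Longrightarrow> class_rep F (class_rep F x) = class_rep F x"
  using class_rep_cong class_rep_rel by blast

lemma class_rep_eq_iff: "equiv B F \<Longrightarrow> x \<in> B \<Longrightarrow> y \<in> B \<Longrightarrow> class_rep F x = class_rep F y \<longleftrightarrow> (x, y) \<in> F"
  by (metis class_rep_cong class_rep_rel equivD(2,3))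

lemma class_rep_in_reps:
  assumes "equiv B F" "x \<in> B" "Q (F `` {x})" shows "class_rep F x \<in> reps B F Q"
  using assms class_rep_rel[OF assms(1,2)] class_rep_idem[OF assms(1,2)] class_eq[OF assms(1), of "class_rep F x" x]
    equivD(4)[OF assms(1)] by (auto simp: reps_def)

text \<open>Least representatives turn counting classes into counting numbers.\<close>

lemma bij_betw_reps:
  assumes "equiv B F" shows "bij_betw (\<lambda>x. F `` {x}) (reps B F Q) (classes B F Q)"
proof (rule bij_betw_imageI)
  show "inj_on (\<lambda>x. F `` {x}) (reps B F Q)"
  proof (rule inj_onI)
    fix x y assume "x \<in> reps B F Q" "y \<in> reps B F Q" "F `` {x} = F `` {y}"
    then show "x = y" using class_rep_cong[OF assms, of x y] eq_equiv_class[OF _ assms, of x y]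
      by (auto simp: reps_def)
  qed
  show "(\<lambda>x. F `` {x}) ` reps B F Q = classes B F Q"
  proof
    show "classes B F Q \<subseteq> (\<lambda>x. F `` {x}) ` reps B F Q"
    proof
      fix c assume "c \<in> classes B F Q"
      then obtain x where x: "x \<in> B" "Q (F `` {x})" "c = F `` {x}" by (auto simp: classes_def)
      have "c = F `` {class_rep F x}" using class_eq[OF assms class_rep_rel[OF assms x(1)]] x by simp
      then show "c \<in> (\<lambda>x. F `` {x}) ` reps B F Q" using class_rep_in_reps[of B F x Q, OF assms x(1,2)] by blast
    qed
  qed (auto simp: reps_def classes_def)
qed

lemma finite_reps_iff: "equiv B F \<Longrightarrow> finite (reps B F Q) \<longleftrightarrow> finite (classes B F Q)"
  by (rule bij_betw_finite) (rule bij_betw_reps)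

lemma card_reps: "equiv B F \<Longrightarrow> card (reps B F Q) = card (classes B F Q)"
  by (rule bij_betw_same_card) (rule bij_betw_reps)

section \<open>Positions of elements within a class\<close>

lemma ex_kth_element:
  fixes M :: "nat set"
  assumes "card_ge (Suc k) M" shows "\<exists>z\<in>M. card {y \<in> M. y < z} = k"
  using assms
proof (induction k)
  case 0
  then have "M \<noteq> {}" by (auto simp: card_ge_def)
  then have "(LEAST z. z \<in> M) \<in> M" by (auto intro: LeastI)
  moreover have "{y \<in> M. y < (LEAST z. z \<in> M)} = {}" using not_less_Least by blast
  ultimately show ?case by (metis card.empty)
next
  case (Suc k)
  then obtain z where z: "z \<in> M" "card {y \<in> M. y < z} = k" by (auto simp: card_ge_def)
  have eq: "{y \<in> M. y \<le> z} = insert z {y \<in> M. y < z}" using z(1) by auto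
  have fin: "finite {y \<in> M. y < z}" by simp
  have c: "card {y \<in> M. y \<le> z} = Suc k" unfolding eq using z(2) fin by simp
  have "\<exists>w. w \<in> M \<and> z < w"
  proof (rule ccontr)
    assume "\<not> ?thesis"
    then have M: "M = {y \<in> M. y \<le> z}" by (auto simp: not_less)
    have "finite M" by (rule finite_subset[of _ "{..z}"]) (use M in auto)
    then show False using Suc.prems c M by (auto simp: card_ge_def)
  qed
  then have w: "(LEAST w. w \<in> M \<and> z < w) \<in> M" "z < (LEAST w. w \<in> M \<and> z < w)" by (metis (mono_tags, lifting) LeastI_ex)+
  have "{y \<in> M. y < (LEAST w. w \<in> M \<and> z < w)} = {y \<in> M. y \<le> z}"
    using w(2) not_less_Least[of _ "\<lambda>w. w \<in> M \<and> z < w"] by (auto simp: not_less[symmetric])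
  then show ?case using w(1) c by metis
qed

lemma idx_alt: "equiv B F \<Longrightarrow> (x, y) \<in> F \<Longrightarrow> idx F y = card {z \<in> F `` {x}. z < y}"
  unfolding idx_def by (rule arg_cong[of _ _ card]) (auto dest: equivD(2) intro: equivD(3))

lemma card_ge_idx:
  assumes "equiv B F" "x \<in> B" shows "card_ge (Suc (idx F x)) (F `` {x})"
proof (cases "finite (F `` {x})")
  case True
  have "x \<in> F `` {x}" using equivD(1)[OF assms] by simp
  then have "{z \<in> F `` {x}. z < x} \<subset> F `` {x}" by auto
  from psubset_card_mono[OF True this] show ?thesis
    using idx_alt[OF assms(1) equivD(1)[OF assms]] by (simp add: card_ge_def)
qed (simp add: card_ge_def)

lemma idx_inj:
  assumes "equiv B F" "(x, y) \<in> F" "idx F x = idx F y" shows "x = y"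
proof -
  have less: "idx F x < idx F y" if "x < y" "(x, y) \<in> F" for x y
  proof -
    have "{z. z < x \<and> (z, x) \<in> F} \<subseteq> {z. z < y \<and> (z, y) \<in> F}"
      using that(1) equivD(3)[OF assms(1) _ that(2)] by auto
    moreover have "x \<in> {z. z < y \<and> (z, y) \<in> F}" "x \<notin> {z. z < x \<and> (z, x) \<in> F}" using that by auto
    ultimately have "{z. z < x \<and> (z, x) \<in> F} \<subset> {z. z < y \<and> (z, y) \<in> F}" by blast
    then show ?thesis unfolding idx_def by (rule psubset_card_mono[rotated]) simp
  qed
  show ?thesis using less[of x y] less[of y x] assms equivD(2)[OF assms(1,2)]
    by (cases x y rule: linorder_cases) auto
qed

lemma dominates_card_ge: "dominates M N \<Longrightarrow> card_ge k N \<Longrightarrow> card_ge k M"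
  by (auto simp: dominates_def card_ge_def)

lemma ex_idx:
  assumes "equiv C G" "y \<in> C" "card_ge (Suc k) (G `` {y})"
  shows "\<exists>z. (y, z) \<in> G \<and> idx G z = k"
  using ex_kth_element[OF assms(3)] idx_alt[OF assms(1)] by auto

section \<open>Embeddings from maps on classes\<close>

lemma embedding_from_class_map:
  assumes B: "ces B F" and C: "ces C G" and g: "computes f g"
    and gC: "\<And>x. x \<in> B \<Longrightarrow> class_rep F x = x \<Longrightarrow> g x \<in> C \<and> dominates (G `` {g x}) (F `` {x})"
    and inj: "\<And>x y. x \<in> B \<Longrightarrow> y \<in> B \<Longrightarrow> class_rep F x = x \<Longrightarrow> class_rep F y = y \<Longrightarrow>
                (g x, g y) \<in> G \<Longrightarrow> x = y"
  shows "\<exists>\<mu>. embedding B F C G \<mu> \<and> computes f \<mu>"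
proof -
  note eF = ces_equiv[OF B] and eG = ces_equiv[OF C]
  \<comment> \<open>Outside \<open>B\<close> the condition is vacuous, so the search returns 0 there
    and \<mu> is total.\<close>
  define Q where "Q x z \<longleftrightarrow> (x \<in> B \<longrightarrow> (g (class_rep F x), z) \<in> G \<and> idx G z = idx F x)" for x z
  define \<mu> where "\<mu> x = (LEAST z. Q x z)" for x
  have rep: "class_rep F x \<in> B" "class_rep F (class_rep F x) = class_rep F x" if "x \<in> B" for x
    using that class_rep_rel[OF eF that] equivD(4)[OF eF] class_rep_idem[OF eF that] by auto
  have ex: "\<exists>z. Q x z" for x
  proof (cases "x \<in> B")
    case True
    have "card_ge (Suc (idx F x)) (F `` {class_rep F x})"
      using card_ge_idx[OF eF True] class_eq[OF eF class_rep_rel[OF eF True]] by simp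
    then have "card_ge (Suc (idx F x)) (G `` {g (class_rep F x)})"
      using dominates_card_ge gC rep[OF True] by blast
    then show ?thesis using ex_idx[OF eG] gC rep[OF True] by (auto simp: Q_def)
  qed (simp add: Q_def)
  have \<mu>: "(g (class_rep F x), \<mu> x) \<in> G" "idx G (\<mu> x) = idx F x" if "x \<in> B" for x
    using LeastI_ex[OF ex[of x]] that by (auto simp: \<mu>_def Q_def)
  have rel: "(x, y) \<in> F \<longleftrightarrow> (\<mu> x, \<mu> y) \<in> G" if "x \<in> B" "y \<in> B" for x y
  proof -
    have "(\<mu> x, \<mu> y) \<in> G \<longleftrightarrow> (g (class_rep F x), g (class_rep F y)) \<in> G"
      using \<mu>(1)[OF that(1)] \<mu>(1)[OF that(2)] equivD(2,3)[OF eG] by meson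
    also have "\<dots> \<longleftrightarrow> class_rep F x = class_rep F y"
      using inj rep that gC equivD(1)[OF eG] by metis
    finally show ?thesis using class_rep_eq_iff[OF eF that] by simp
  qed
  have "embedding B F C G \<mu>" unfolding embedding_def
  proof (intro conjI ballI)
    show "\<mu> ` B \<subseteq> C" using \<mu>(1) equivD(5)[OF eG] by blast
    show "inj_on \<mu> B"
    proof (rule inj_onI)
      fix x y assume xy: "x \<in> B" "y \<in> B" "\<mu> x = \<mu> y"
      have "(\<mu> x, \<mu> x) \<in> G" using \<mu>(1)[OF xy(1)] equivD(1,5)[OF eG] by blast
      then have "(x, y) \<in> F" using rel xy by simp
      then show "x = y" using idx_inj[OF eF] \<mu>(2) xy by metis
    qed
  qed (use rel in auto)
  moreover have "computes f \<mu>" unfolding \<mu>_def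
    using ex unfolding Q_def
    by (intro computability decides_universe[OF B] decides_rel[OF C] computes_comp[OF g] computes_class_rep[OF B] computes_idx[OF B] computes_idx[OF C])
  ultimately show ?thesis by blast
qed

text \<open>Finitely many classes are sent along the table \<open>t\<close>; the others are matched greedily, each new
  target being chosen among classes avoiding everything below the targets used so far.\<close>
lemma embedding_by_search:
  assumes B: "ces B F" and C: "ces C G" and fin: "finite M"
    and t: "\<And>a. a \<in> M \<Longrightarrow> t a \<in> C \<and> dominates (G `` {t a}) (F `` {a})"
    and t_inj: "\<And>a b. a \<in> M \<Longrightarrow> b \<in> M \<Longrightarrow> (t a, t b) \<in> G \<Longrightarrow> a = b"
    and P: "decides f (\<lambda>z. P (pfst z) (psnd z))"
    and ex: "\<And>n m. n \<in> B \<Longrightarrow> class_rep F n = n \<Longrightarrow> n \<notin> M \<Longrightarrow> \<exists>v\<in>C. (\<forall>u<m. (u, v) \<notin> G) \<and> P n v"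
    and dom: "\<And>n v. n \<in> B \<Longrightarrow> class_rep F n = n \<Longrightarrow> n \<notin> M \<Longrightarrow> v \<in> C \<Longrightarrow> P n v \<Longrightarrow>
                dominates (G `` {v}) (F `` {n})"
  shows "\<exists>\<mu>. embedding B F C G \<mu> \<and> computes f \<mu>"
proof -
  note eF = ces_equiv[OF B] and eG = ces_equiv[OF C]
  define N where "N n \<longleftrightarrow> n \<in> B \<and> class_rep F n = n \<and> n \<notin> M" for n
  obtain b where b: "\<And>a. a \<in> M \<Longrightarrow> t a < b"
    using finite_nat_set_iff_bounded[of "t ` M"] fin by auto
  \<comment> \<open>Here \<open>r\<close> lies strictly above all targets used so far. Avoiding the
    classes of all numbers below \<open>r\<close> ensures freshness; if \<open>n\<close> requires no
    search, \<open>v = r\<close> will do.\<close>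
  define R where "R n r v \<longleftrightarrow> r \<le> v \<and> (N n \<longrightarrow> v \<in> C \<and> (\<forall>u<r. (u, v) \<notin> G) \<and> P n v)" for n r v
  \<comment> \<open>\<open>w n\<close> is a strict bound for the targets of searched inputs below
    \<open>n\<close>, starting at the bound \<open>b\<close> of the table. The target of
    \<open>n\<close> is thus recovered as \<open>w (Suc n) - 1\<close>.\<close>
  define w where "w = rec_nat b (\<lambda>n r. Suc (LEAST v. R n r v))"
  define g where "g n = (if n \<in> M then t n else w (Suc n) - 1)" for n
  have exR: "\<exists>v. R n r v" for n r
  proof (cases "N n")
    case True
    then obtain v where v: "v \<in> C" "\<forall>u<r. (u, v) \<notin> G" "P n v" using ex unfolding N_def by blast
    have "r \<le> v" using v(1,2) equivD(1)[OF eG] by (meson not_less)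
    with v show ?thesis by (auto simp: R_def)
  qed (auto simp: R_def)
  have step: "R n (w n) (w (Suc n) - 1)" "w n < w (Suc n)" for n
    using LeastI_ex[OF exR[of n "w n"]] by (auto simp: w_def R_def)
  have w_mono: "m \<le> n \<Longrightarrow> w m \<le> w n" for m n
    using step(2) by (metis less_imp_le lift_Suc_mono_le)
  have g_less: "g n < w (Suc n)" for n
    using step(2)[of n] b[of n] w_mono[of 0 "Suc n"] by (auto simp: g_def w_def)
  have g_M: "g n < w 0" if "n \<in> M" for n using b that by (simp add: g_def w_def)
  have fresh: "(u, g n) \<notin> G" if "N n" "u < w n" for n u
    using step(1)[of n] that by (auto simp: R_def g_def N_def)
  have RM: "computes f (\<lambda>x. LEAST v. R (h1 x) (h2 x) v)" if "computes f h1" "computes f h2" for h1 h2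
    using exR unfolding R_def N_def
    by (intro computability decides_universe[OF B] decides_universe[OF C] decides_rel[OF C] computes_class_rep[OF B] decides2[OF P]
        decides_comp[OF decides_finite[OF fin]] computes_comp[OF that(1)] computes_comp[OF that(2)])
  have "computes f g" unfolding g_def w_def
    by (intro computes_finite_patch fin computability RM)
  moreover have "g x \<in> C \<and> dominates (G `` {g x}) (F `` {x})" if "x \<in> B" "class_rep F x = x" for x
    using step(1)[of x] t[of x] dom[of x] that by (auto simp: g_def R_def N_def)
  moreover have "x = y" if *: "x \<in> B" "y \<in> B" "class_rep F x = x" "class_rep F y = y" "(g x, g y) \<in> G" for x y
  proof (rule ccontr)
    assume ne: "x \<noteq> y"
    have "False" if "N y" "x \<in> M \<or> x < y" "(g x, g y) \<in> G" for x y
    proof -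
      have "g x < w y"
        using that(2) g_M[of x] g_less[of x] w_mono[of 0 y] w_mono[of "Suc x" y] by auto
      then show False using fresh[OF that(1)] that(3) by blast
    qed
    moreover have "(g y, g x) \<in> G" using *(5) equivD(2)[OF eG] by blast
    moreover have "\<not> (x \<in> M \<and> y \<in> M)" using t_inj *(5) ne by (auto simp: g_def)
    ultimately show False using * ne unfolding N_def by (metis linorder_neqE_nat)
  qed
  ultimately show ?thesis by (intro embedding_from_class_map[OF B C, of f g]) blast+
qed

section \<open>Transport of classes along embeddings\<close>

lemma embeddingD:
  assumes "embedding B F C G \<mu>"
  shows "x \<in> B \<Longrightarrow> \<mu> x \<in> C" "inj_on \<mu> B" "x \<in> B \<Longrightarrow> y \<in> B \<Longrightarrow> (\<mu> x, \<mu> y) \<in> G \<longleftrightarrow> (x, y) \<in> F"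
  using assms by (auto simp: embedding_def)

lemma embedding_comp:
  assumes "embedding B F C G \<mu>" "embedding C G D H \<nu>" shows "embedding B F D H (\<nu> \<circ> \<mu>)"
  using assms unfolding embedding_def
  by (auto intro: comp_inj_on inj_on_subset simp: image_subset_iff)

lemma embedding_image_class:
  assumes "equiv B F" "embedding B F C G \<mu>" "x \<in> B"
  shows "\<mu> ` (F `` {x}) \<subseteq> G `` {\<mu> x}" "inj_on \<mu> (F `` {x})"
proof -
  have "F `` {x} \<subseteq> B" using equivD(5)[OF assms(1)] by blast
  then show "\<mu> ` (F `` {x}) \<subseteq> G `` {\<mu> x}" "inj_on \<mu> (F `` {x})"
    using embeddingD[OF assms(2)] assms(3) by (auto intro: inj_on_subset)
qed

lemma embedding_dominates:
  assumes "equiv B F" "embedding B F C G \<mu>" "x \<in> B"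
  shows "dominates (G `` {\<mu> x}) (F `` {x})"
  using embedding_image_class[OF assms] unfolding dominates_def
  by (metis card_image card_mono finite_imageD finite_subset)

lemma embedding_infinite_class:
  "equiv B F \<Longrightarrow> embedding B F C G \<mu> \<Longrightarrow> x \<in> B \<Longrightarrow> infinite (F `` {x}) \<Longrightarrow> infinite (G `` {\<mu> x})"
  using embedding_dominates by (auto simp: dominates_def)

lemma embedding_card_ge_class:
  "equiv B F \<Longrightarrow> embedding B F C G \<mu> \<Longrightarrow> x \<in> B \<Longrightarrow> card_ge k (F `` {x}) \<Longrightarrow> card_ge k (G `` {\<mu> x})"
  using embedding_dominates dominates_card_ge by blast

lemma transport_classes:
  assumes "equiv B F" "equiv C G" "embedding B F C G \<mu>"
    and "\<And>x. x \<in> B \<Longrightarrow> Q (F `` {x}) \<Longrightarrow> Q' (G `` {\<mu> x})"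
  shows "inj_on (\<lambda>x. G `` {\<mu> x}) (reps B F Q)" "(\<lambda>x. G `` {\<mu> x}) ` reps B F Q \<subseteq> classes C G Q'"
proof -
  show "inj_on (\<lambda>x. G `` {\<mu> x}) (reps B F Q)"
  proof (rule inj_onI)
    fix x y assume xy: "x \<in> reps B F Q" "y \<in> reps B F Q" "G `` {\<mu> x} = G `` {\<mu> y}"
    then have "(\<mu> x, \<mu> y) \<in> G" using embeddingD(1)[OF assms(3)]
      by (intro eq_equiv_class[OF _ assms(2)]) (auto simp: reps_def)
    then show "x = y" using xy embeddingD(3)[OF assms(3)] class_rep_cong[OF assms(1), of x y] by (auto simp: reps_def)
  qed
  show "(\<lambda>x. G `` {\<mu> x}) ` reps B F Q \<subseteq> classes C G Q'"
    using assms(4) embeddingD(1)[OF assms(3)] by (auto simp: reps_def classes_def)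
qed

lemma transport_finite_classes:
  assumes "equiv B F" "equiv C G" "embedding B F C G \<mu>" "finite (classes C G Q')"
    and "\<And>x. x \<in> B \<Longrightarrow> Q (F `` {x}) \<Longrightarrow> Q' (G `` {\<mu> x})"
  shows "finite (classes B F Q)" "card (classes B F Q) \<le> card (classes C G Q')"
proof -
  note tr = transport_classes[OF assms(1-3), of Q Q', OF assms(5)]
  show "finite (classes B F Q)"
    using finite_reps_iff[OF assms(1), of Q] inj_on_finite[OF tr assms(4)] by simp
  show "card (classes B F Q) \<le> card (classes C G Q')"
    using card_reps[OF assms(1), of Q] card_inj_on_le[OF tr assms(4)] by simp
qed

text \<open>The numbers below \<open>m\<close> meet only finitely many classes.\<close>

lemma ex_fresh_class:
  assumes "infinite (classes C G Q)" "equiv C G"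
  shows "\<exists>v\<in>C. (\<forall>u<m. (u, v) \<notin> G) \<and> Q (G `` {v})"
proof (rule ccontr)
  assume *: "\<not> ?thesis"
  have "classes C G Q \<subseteq> (\<lambda>u. G `` {u}) ` {..<m}"
  proof
    fix c assume "c \<in> classes C G Q"
    then obtain v where v: "v \<in> C" "Q (G `` {v})" "c = G `` {v}" by (auto simp: classes_def)
    then obtain u where "u < m" "(u, v) \<in> G" using * by blast
    then show "c \<in> (\<lambda>u. G `` {u}) ` {..<m}" using v class_eq[OF assms(2)] by blast
  qed
  then show False using assms(1) finite_subset by blast
qed

text \<open>An embedding between bi-embeddable structures permutes the finitely many infinite classes, so it
  cannot absorb a finite class into an infinite one.\<close>
lemma finite_class_to_finite_class:
  assumes "equiv B F" "equiv C G" "embedding B F C G \<mu>" "embedding C G B F \<nu>"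
    "finite (classes B F infinite)" "x \<in> B" "finite (F `` {x})"
  shows "finite (G `` {\<mu> x})"
proof (rule ccontr)
  assume inf: "infinite (G `` {\<mu> x})"
  note eF = assms(1)
  define h where "h = \<nu> \<circ> \<mu>"
  have h: "embedding B F B F h" unfolding h_def by (rule embedding_comp[OF assms(3,4)])
  let ?R = "reps B F infinite"
  have fR: "finite ?R" using assms(5) finite_reps_iff[OF eF] by simp
  have "(\<lambda>y. class_rep F (h y)) ` ?R \<subseteq> ?R"
  proof (rule image_subsetI)
    fix y assume "y \<in> ?R"
    then have "y \<in> B" "infinite (F `` {y})" by (auto simp: reps_def)
    then show "class_rep F (h y) \<in> ?R"
      by (intro class_rep_in_reps[OF eF] embedding_infinite_class[OF eF h] embeddingD(1)[OF h])
  qed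
  moreover have "inj_on (\<lambda>y. class_rep F (h y)) ?R"
  proof (rule inj_onI)
    fix y z assume yz: "y \<in> ?R" "z \<in> ?R" "class_rep F (h y) = class_rep F (h z)"
    then have "(y, z) \<in> F" using class_rep_eq_iff[OF eF] embeddingD(1,3)[OF h] by (auto simp: reps_def)
    then show "y = z" using yz class_rep_cong[OF eF, of y z] by (simp add: reps_def)
  qed
  ultimately have surj: "(\<lambda>y. class_rep F (h y)) ` ?R = ?R" using endo_inj_surj[OF fR] by blast
  have "infinite (F `` {h x})"
    using embedding_infinite_class[OF assms(2,4) _ inf] embeddingD(1)[OF assms(3,6)] by (simp add: h_def)
  then have "class_rep F (h x) \<in> ?R" using embeddingD(1)[OF h assms(6)] by (intro class_rep_in_reps[OF eF])
  then obtain y where y: "y \<in> ?R" "class_rep F (h x) = class_rep F (h y)" using surj by (metis (no_types, lifting) imageE)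
  then have "(x, y) \<in> F" using class_rep_eq_iff[OF eF] embeddingD(1,3)[OF h] assms(6) by (auto simp: reps_def)
  then show False using class_eq[OF eF] y(1) assms(7) by (auto simp: reps_def)
qed

section \<open>Upper bounds for embeddings\<close>

text \<open>Let \<open>j\<close> be least such that only finitely many classes have size at least
  \<open>j\<close>. Those follow the given embedding through a finite table. All others have size at
  most \<open>j - 1\<close>, whereas infinitely many source classes, hence infinitely many target
  classes, have size at least \<open>j - 1\<close>: a fresh and large enough target always exists
  and is recognised by finite evidence.\<close>

lemma embedding_bounded:
  assumes B: "ces B F" and C: "ces C G" and bd: "bounded_character B F"
    and fin: "finite (classes B F infinite)" and \<mu>: "embedding B F C G \<mu>"
  shows "\<exists>\<mu>. embedding B F C G \<mu> \<and> computes f \<mu>"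
proof -
  note eF = ces_equiv[OF B] and eG = ces_equiv[OF C]
  obtain k where k: "\<And>x. x \<in> B \<Longrightarrow> finite (F `` {x}) \<Longrightarrow> card (F `` {x}) \<le> k"
    using bd by (auto simp: bounded_character_def)
  have "classes B F (card_ge (Suc k)) = classes B F infinite"
    using k by (fastforce simp: classes_def card_ge_def)
  then have ex: "\<exists>j. finite (classes B F (card_ge j))" using fin by metis
  define j where "j = (LEAST j. finite (classes B F (card_ge j)))"
  define M where "M = reps B F (card_ge j)"
  have "finite M" using LeastI_ex[OF ex] finite_reps_iff[OF eF] by (simp add: M_def j_def)
  \<comment> \<open>The searched element \<open>v\<close> is itself the evidence: its position shows
    that its class has at least \<open>j - 1\<close> members.\<close>
  define P where "P (n::nat) v \<longleftrightarrow> j - 1 \<le> Suc (idx G v)" for n v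
  have small: "finite (F `` {n})" "card (F `` {n}) \<le> j - 1" "0 < j"
    if "n \<in> B" "class_rep F n = n" "n \<notin> M" for n
    using that by (auto simp: M_def reps_def card_ge_def)
  show ?thesis
  proof (rule embedding_by_search[OF B C \<open>finite M\<close>, of \<mu> f P])
    show "\<mu> a \<in> C \<and> dominates (G `` {\<mu> a}) (F `` {a})" if "a \<in> M" for a
      using that embeddingD(1)[OF \<mu>] embedding_dominates[OF eF \<mu>] by (simp add: M_def reps_def)
    show "a = b" if "a \<in> M" "b \<in> M" "(\<mu> a, \<mu> b) \<in> G" for a b
      using that embeddingD(3)[OF \<mu>] class_rep_cong[OF eF, of a b] by (auto simp: M_def reps_def)
    show "decides f (\<lambda>z. P (pfst z) (psnd z))" unfolding P_def by (intro computability computes_idx[OF C])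
    show "dominates (G `` {v}) (F `` {n})" if "n \<in> B" "class_rep F n = n" "n \<notin> M" "v \<in> C" "P n v" for n v
      using small[OF that(1-3)] card_ge_idx[OF eG that(4)] that(5)
      by (auto simp: P_def dominates_def card_ge_def)
    show "\<exists>v\<in>C. (\<forall>u<m. (u, v) \<notin> G) \<and> P n v" if n: "n \<in> B" "class_rep F n = n" "n \<notin> M" for n m
    proof -
      have "infinite (classes B F (card_ge (j - 1)))"
        using not_less_Least[of "j - 1" "\<lambda>j. finite (classes B F (card_ge j))"] small(3)[OF n]
        by (simp add: j_def)
      then have "infinite (classes C G (card_ge (j - 1)))"
        using transport_finite_classes(1)[OF eF eG \<mu>] embedding_card_ge_class[OF eF \<mu>] by blast
      then obtain v where v: "v \<in> C" "\<forall>u<m. (u, v) \<notin> G" "card_ge (j - 1) (G `` {v})"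
        using ex_fresh_class[OF _ eG] by blast
      show ?thesis
      proof (cases "j - 1")
        case 0
        then show ?thesis using v by (auto simp: P_def)
      next
        case (Suc i)
        then obtain z where z: "(v, z) \<in> G" "idx G z = i" using ex_idx[OF eG v(1)] v(3) by metis
        have "(u, z) \<notin> G" if "u < m" for u using v(2) z(1) that equivD(2,3)[OF eG] by meson
        then show ?thesis using z Suc equivD(5)[OF eG z(1)] by (auto simp: P_def)
      qed
    qed
  qed
qed

text \<open>Bounding all initial segments expresses a size bound as a universal condition with
  decidable matrix, which one jump decides.\<close>

lemma card_ge_finite_parts:
  fixes M :: "nat set"
  assumes "\<And>y. card {z. z < y \<and> z \<in> M} \<le> k" shows "finite M" "card M \<le> k"
proof -
  have "\<not> card_ge (Suc k) M"
  proof
    assume "card_ge (Suc k) M"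
    then obtain z where z: "z \<in> M" "card {y \<in> M. y < z} = k" using ex_kth_element by blast
    have "{y. y < Suc z \<and> y \<in> M} = insert z {y \<in> M. y < z}" using z(1) by auto
    then have "card {y. y < Suc z \<and> y \<in> M} = Suc k" using z(2) by simp
    then show False using assms[of "Suc z"] by simp
  qed
  then show "finite M" "card M \<le> k" by (auto simp: card_ge_def)
qed

text \<open>Counting infinite classes replaces an assumed embedding, so the lemma also shows that
  the coding structures below are bi-embeddable with the given one.\<close>

lemma embedding_unbounded:
  assumes B: "ces B F" and C: "ces C G" and ub: "\<not> bounded_character C G"
    and finB: "finite (classes B F infinite)" and finC: "finite (classes C G infinite)"
    and le: "card (classes B F infinite) \<le> card (classes C G infinite)"
  shows "\<exists>\<mu>. embedding B F C G \<mu> \<and> computes (chi (jump {})) \<mu>"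
proof -
  note eF = ces_equiv[OF B] and eG = ces_equiv[OF C]
  define M where "M = reps B F infinite"
  have fM: "finite M" using finB finite_reps_iff[OF eF] by (simp add: M_def)
  have "card M \<le> card (reps C G infinite)" using le by (simp add: M_def card_reps[OF eF] card_reps[OF eG])
  then obtain t where t: "t ` M \<subseteq> reps C G infinite" "inj_on t M"
    using card_le_inj[OF fM finite_reps_iff[OF eG, THEN iffD2, OF finC]] by blast
  define P where "P n v \<longleftrightarrow> (\<forall>y. card {z. z < y \<and> (z, n) \<in> F} \<le> Suc (idx G v))" for n v
  have cls: "{z. z < y \<and> (z, n) \<in> F} = {z. z < y \<and> z \<in> F `` {n}}" for y n
    using equivD(2)[OF eF] by blast
  show ?thesis
  proof (rule embedding_by_search[OF B C fM, of t _ P])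
    show "t a \<in> C \<and> dominates (G `` {t a}) (F `` {a})" if "a \<in> M" for a
      using that t(1) by (auto simp: reps_def dominates_def)
    show "a = b" if "a \<in> M" "b \<in> M" "(t a, t b) \<in> G" for a b
    proof -
      have "t a \<in> reps C G infinite" "t b \<in> reps C G infinite" using t that by auto
      then have "t a = t b" using class_rep_cong[OF eG that(3)] by (simp add: reps_def)
      then show ?thesis using t(2) that by (simp add: inj_on_eq_iff)
    qed
    show "decides (chi (jump {})) (\<lambda>z. P (pfst z) (psnd z))" unfolding P_def
      by (intro decides_jump_all computability decides_rel[OF B] computes_idx[OF C])
    show "dominates (G `` {v}) (F `` {n})" if "v \<in> C" "P n v" for n v
      using card_ge_finite_parts[of "F `` {n}" "Suc (idx G v)"] that(2) card_ge_idx[OF eG that(1)]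
      by (auto simp: P_def cls dominates_def card_ge_def)
    show "\<exists>v\<in>C. (\<forall>u<m. (u, v) \<notin> G) \<and> P n v" if n: "n \<in> B" "class_rep F n = n" "n \<notin> M" for n m
    proof -
      have fn: "finite (F `` {n})" using n by (simp add: M_def reps_def)
      \<comment> \<open>The sum is at least the size of every finite class of a number below
        \<open>m\<close>, so a finite class with more than \<open>k\<close> members is automatically
        fresh as well as large enough.\<close>
      define k where "k = card (F `` {n}) + (\<Sum>u<m. card (G `` {u}))"
      obtain v where v: "v \<in> C" "finite (G `` {v})" "k < card (G `` {v})"
        using ub unfolding bounded_character_def by (meson not_le)
      then have "card_ge (Suc (card (G `` {v}) - 1)) (G `` {v})" by (simp add: card_ge_def)
      then obtain z where z: "(v, z) \<in> G" "idx G z = card (G `` {v}) - 1" using ex_idx[OF eG v(1)] by blast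
      have "(u, z) \<notin> G" if "u < m" for u
      proof
        assume "(u, z) \<in> G"
        then have "G `` {u} = G `` {v}" using class_eq[OF eG] z(1) by metis
        moreover have "card (G `` {u}) \<le> (\<Sum>u<m. card (G `` {u}))"
          using that by (intro member_le_sum) auto
        ultimately show False using v(3) by (simp add: k_def)
      qed
      moreover have "P n z" unfolding P_def cls
      proof
        fix y
        have "card {z. z < y \<and> z \<in> F `` {n}} \<le> card (F `` {n})" by (rule card_mono[OF fn]) auto
        then show "card {z. z < y \<and> z \<in> F `` {n}} \<le> Suc (idx G z)" using z(2) v(3) by (simp add: k_def)
      qed
      ultimately show ?thesis using equivD(5)[OF eG z(1)] by blast
    qed
  qed
qed

text \<open>An infinite class dominates every class, so the source may be arbitrary. In particular
  all computable equivalence structures with infinitely many infinite classes are bi-embeddable with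
  each other.\<close>

lemma embedding_infinitely_many:
  assumes B: "ces B F" and C: "ces C G" and inf: "infinite (classes C G infinite)"
  shows "\<exists>\<mu>. embedding B F C G \<mu> \<and> computes (chi (jump (jump {}))) \<mu>"
proof -
  note eG = ces_equiv[OF C]
  define P where "P (n::nat) v \<longleftrightarrow> (\<forall>x. \<exists>y. x < y \<and> (v, y) \<in> G)" for n v
  have P_iff: "P n v \<longleftrightarrow> infinite (G `` {v})" for n v
    by (auto simp: P_def finite_nat_set_iff_bounded_le not_le)
  show ?thesis
  proof (rule embedding_by_search[OF B C finite.emptyI, of _ _ P])
    show "decides (chi (jump (jump {}))) (\<lambda>z. P (pfst z) (psnd z))" unfolding P_def
      by (intro decides_jump_all decides_jump_ex computability decides_rel[OF C])
    show "\<exists>v\<in>C. (\<forall>u<m. (u, v) \<notin> G) \<and> P n v" for n m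
      using ex_fresh_class[OF inf eG] by (simp add: P_iff)
    show "dominates (G `` {v}) (F `` {n})" if "P n v" for n v
      using that by (simp add: P_iff dominates_def)
  qed auto
qed

section \<open>Computable bi-embeddable copies\<close>

text \<open>A copy is only assumed to be a computable structure; the axioms of an equivalence
  relation are universal and pull back along its embedding into \<open>A\<close>.\<close>

lemma comp_be_copy_ces:
  assumes "ces A E" "comp_be_copy A E B F" shows "ces B F"
proof -
  note eE = ces_equiv[OF assms(1)]
  obtain \<nu> where \<nu>: "embedding B F A E \<nu>"
    using assms(2) by (auto simp: comp_be_copy_def bi_embeddable_def)
  have cs: "computable_structure B F" "F \<subseteq> B \<times> B"
    using assms(2) by (auto simp: comp_be_copy_def computable_structure_def)
  have "equiv B F"
  proof (rule equivI)
    show "refl_on B F"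
      using cs(2) embeddingD(1,3)[OF \<nu>] equivD(1)[OF eE] unfolding refl_on_def by blast
    show "sym F"
    proof (rule symI)
      fix x y assume xy: "(x, y) \<in> F"
      then have "x \<in> B" "y \<in> B" using cs(2) by auto
      then show "(y, x) \<in> F" using xy embeddingD(3)[OF \<nu>] equivD(2)[OF eE] by blast
    qed
    show "trans F"
    proof (rule transI)
      fix x y z assume xyz: "(x, y) \<in> F" "(y, z) \<in> F"
      then have "x \<in> B" "y \<in> B" "z \<in> B" using cs(2) by auto
      then show "(x, z) \<in> F" using xyz embeddingD(3)[OF \<nu>] equivD(3)[OF eE] by blast
    qed
  qed (use cs(2) in auto)
  with cs(1) show ?thesis by (simp add: computable_equiv_structure_def)
qed

lemma comp_be_copyI:
  "ces B F \<Longrightarrow> embedding A E B F \<mu> \<Longrightarrow> embedding B F A E \<nu> \<Longrightarrow> comp_be_copy A E B F"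
  by (auto simp: comp_be_copy_def bi_embeddable_def computable_equiv_structure_def)

lemma comp_be_copyE:
  assumes "comp_be_copy A E B F" "ces A E"
  obtains \<mu> \<nu> where "ces B F" "embedding A E B F \<mu>" "embedding B F A E \<nu>"
  using assms comp_be_copy_ces[OF assms(2,1)] by (auto simp: comp_be_copy_def bi_embeddable_def)

lemma infinite_classes_le:
  assumes "ces B F" "ces C G" "embedding B F C G \<mu>" "finite (classes C G infinite)"
  shows "finite (classes B F infinite)" "card (classes B F infinite) \<le> card (classes C G infinite)"
  by (rule transport_finite_classes[OF ces_equiv[OF assms(1)] ces_equiv[OF assms(2)] assms(3,4)],
      erule (1) embedding_infinite_class[OF ces_equiv[OF assms(1)] assms(3)])+

text \<open>A size bound pulls back because finite classes go to finite classes. With infinitely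
  many infinite classes bounded character would not be invariant under bi-embeddability.\<close>

lemma bounded_character_transfer:
  assumes "ces B F" "ces C G" "embedding B F C G \<mu>" "embedding C G B F \<nu>"
    "finite (classes B F infinite)" "bounded_character C G"
  shows "bounded_character B F"
proof -
  note eF = ces_equiv[OF assms(1)] and eG = ces_equiv[OF assms(2)]
  obtain k where k: "\<And>y. y \<in> C \<Longrightarrow> finite (G `` {y}) \<Longrightarrow> card (G `` {y}) \<le> k"
    using assms(6) by (auto simp: bounded_character_def)
  have "card (F `` {x}) \<le> k" if x: "x \<in> B" "finite (F `` {x})" for x
  proof -
    have "finite (G `` {\<mu> x})" by (rule finite_class_to_finite_class[OF eF eG assms(3,4,5) x])
    then show ?thesis
      using embedding_dominates[OF eF assms(3) x(1)] k[OF embeddingD(1)[OF assms(3) x(1)]]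
      by (auto simp: dominates_def)
  qed
  then show ?thesis by (auto simp: bounded_character_def)
qed

text \<open>A program for \<mu> may diverge off \<open>B\<close>, so a case distinction that
  evaluates both branches would fail. Instead \<open>r\<close> runs \<open>p\<close> inside a
  recursion whose number of rounds is the characteristic value of \<open>B\<close> at
  \<open>x\<close>: off \<open>B\<close> it is never started.\<close>

lemma computes_extend_zero:
  assumes "decides f (\<lambda>x. x \<in> B)" "computable_on_from f B \<mu>"
  shows "computes f (\<lambda>x. if x \<in> B then \<mu> x else 0)"
proof -
  obtain q where q: "\<And>x. eval f q x (if x \<in> B then 1 else 0)" using assms(1) by (auto simp: decides_def computes_def)
  obtain p where p: "\<And>x. x \<in> B \<Longrightarrow> eval f p x (\<mu> x)" using assms(2) by (auto simp: computable_on_from_def)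
  define r where "r = Rec Z (Comp p (Comp Fst Fst))"
  have r0: "eval f r (prod_encode (x, 0)) 0" for x
    unfolding r_def by (intro ev_Rec0 ev_Z)
  have r1: "eval f r (prod_encode (x, Suc 0)) (\<mu> x)" if "x \<in> B" for x
  proof -
    have "eval f (Comp Fst Fst) (prod_encode (prod_encode (x, 0), 0)) x"
      using ev_Comp[OF ev_Fst[of f "prod_encode (prod_encode (x, 0), 0)"] ev_Fst[of f]] by simp
    from ev_RecS[OF r0[unfolded r_def] ev_Comp[OF this p[OF that]]] show ?thesis by (simp add: r_def)
  qed
  have "eval f (Comp r (Pair Ident q)) x (if x \<in> B then \<mu> x else 0)" for x
    using ev_Comp[OF ev_Pair[OF ev_Id q[of x]], of r] r0[of x] r1[of x] by auto
  then show ?thesis unfolding computes_def by blast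
qed

lemma embedding_cong:
  "(\<And>x. x \<in> B \<Longrightarrow> \<mu> x = \<mu>' x) \<Longrightarrow> embedding B F C G \<mu> \<longleftrightarrow> embedding B F C G \<mu>'"
  unfolding embedding_def by (auto cong: inj_on_cong)

text \<open>One pair of copies gives both leastness and strength: whatever computes embeddings
  between them computes their join, hence \<open>D\<close>.\<close>

lemma strong_degreeI:
  assumes A: "ces A E"
    and upper: "\<And>B F C G. comp_be_copy A E B F \<Longrightarrow> comp_be_copy A E C G \<Longrightarrow>
                  \<exists>\<mu>. embedding B F C G \<mu> \<and> computes (chi D) \<mu>"
    and copies: "comp_be_copy A E B0 F0" "comp_be_copy A E B1 F1"
    and lower: "\<And>\<mu> \<nu>. embedding B0 F0 B1 F1 \<mu> \<Longrightarrow> embedding B1 F1 B0 F0 \<nu> \<Longrightarrow>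
                  decides (join \<mu> \<nu>) (\<lambda>x. x \<in> D)"
  shows "strong_degree_of_bec D A E"
proof -
  have "bec_computes D A E"
    unfolding bec_computes_def using upper computes_imp_computable_on by meson
  moreover have "turing_le D Y" if Y: "bec_computes Y A E" for Y
  proof -
    obtain \<mu> \<nu> where \<mu>: "embedding B0 F0 B1 F1 \<mu>" "computable_on_from (chi Y) B0 \<mu>"
      and \<nu>: "embedding B1 F1 B0 F0 \<nu>" "computable_on_from (chi Y) B1 \<nu>"
      using Y copies unfolding bec_computes_def by meson
    \<comment> \<open>The join has to be total, whereas \<mu> and \<nu> are only computable on their
      universes.\<close>
    define \<mu>' where "\<mu>' x = (if x \<in> B0 then \<mu> x else 0)" for x
    define \<nu>' where "\<nu>' x = (if x \<in> B1 then \<nu> x else 0)" for x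
    have B: "ces B0 F0" "ces B1 F1" using copies comp_be_copy_ces[OF A] by auto
    have "computes (chi Y) \<mu>'" "computes (chi Y) \<nu>'"
      unfolding \<mu>'_def \<nu>'_def using \<mu>(2) \<nu>(2) decides_universe[OF B(1) computes_id] decides_universe[OF B(2) computes_id]
      by (auto intro: computes_extend_zero)
    note \<mu>\<nu>' = this
    have "computes (chi Y) (join \<mu>' \<nu>')" unfolding join_def
      by (intro computability computes_comp[OF \<mu>\<nu>'(1)] computes_comp[OF \<mu>\<nu>'(2)])
    moreover have "embedding B0 F0 B1 F1 \<mu>'" "embedding B1 F1 B0 F0 \<nu>'"
      using \<mu>(1) \<nu>(1) embedding_cong[of B0 \<mu> \<mu>'] embedding_cong[of B1 \<nu> \<nu>'] by (auto simp: \<mu>'_def \<nu>'_def)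
    ultimately have "decides (chi Y) (\<lambda>x. x \<in> D)" using lower decides_trans by blast
    then show ?thesis by (simp add: turing_le_def set_le_fun_iff)
  qed
  ultimately show ?thesis unfolding strong_degree_of_bec_def degree_of_bec_def set_le_fun_iff
    using copies lower by blast
qed

section \<open>Column structures\<close>

definition columns :: "nat set \<Rightarrow> (nat \<times> nat) set" where
  "columns U = {(x, y). x \<in> U \<and> y \<in> U \<and> pfst x = pfst y}"

lemma columns_class: "x \<in> U \<Longrightarrow> columns U `` {x} = ppair (pfst x) ` {i. ppair (pfst x) i \<in> U}"
proof (rule set_eqI)
  fix y assume "x \<in> U"
  then show "y \<in> columns U `` {x} \<longleftrightarrow> y \<in> ppair (pfst x) ` {i. ppair (pfst x) i \<in> U}"
    by (auto simp: columns_def image_iff) (metis ppair_pfst_psnd)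
qed

lemma inj_ppair: "inj_on (ppair c) M"
  by (auto simp: inj_on_def)

lemma finite_columns_class: "x \<in> U \<Longrightarrow> finite (columns U `` {x}) \<longleftrightarrow> finite {i. ppair (pfst x) i \<in> U}"
  by (simp add: columns_class finite_image_iff inj_ppair)

lemma card_columns_class: "x \<in> U \<Longrightarrow> card (columns U `` {x}) = card {i. ppair (pfst x) i \<in> U}"
  by (simp add: columns_class card_image inj_ppair)

lemma ces_columns: assumes "decides (chi {}) (\<lambda>x. x \<in> U)" shows "ces U (columns U)"
  unfolding computable_equiv_structure_def computable_structure_iff
proof (intro conjI assms)
  show "decides (chi {}) (\<lambda>z. (pfst z, psnd z) \<in> columns U)"
    unfolding columns_def by (simp, intro computability decides_comp[OF assms])
qed (auto simp: columns_def intro!: equivI refl_onI symI transI)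

section \<open>Finitely many infinite classes: coding the jump\<close>

text \<open>\<open>m\<close> will be the number of infinite classes of the given structure. By
  \<open>base\<close>, a column \<open>c >= m\<close> has at least \<open>c - m + 1\<close> members,
  which forces unbounded character.\<close>

locale finitely_many_full_columns =
  fixes m :: nat and U :: "nat set"
  assumes decides_U: "decides (chi {}) (\<lambda>x. x \<in> U)"
    and full: "c < m \<Longrightarrow> ppair c i \<in> U"
    and fin: "m \<le> c \<Longrightarrow> finite {i. ppair c i \<in> U}"
    and base: "m \<le> c \<Longrightarrow> i \<le> c - m \<Longrightarrow> ppair c i \<in> U"
begin

lemma ces_U: "ces U (columns U)"
  by (rule ces_columns[OF decides_U])

lemma class_infinite_iff: "x \<in> U \<Longrightarrow> infinite (columns U `` {x}) \<longleftrightarrow> pfst x < m"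
  using full[of "pfst x"] fin[of "pfst x"] by (auto simp: finite_columns_class not_less[symmetric])

lemma bij_infinite_classes: "bij_betw (\<lambda>c. columns U `` {ppair c 0}) {..<m} (classes U (columns U) infinite)"
proof (rule bij_betw_imageI)
  show "inj_on (\<lambda>c. columns U `` {ppair c 0}) {..<m}"
  proof (rule inj_onI)
    fix c d assume "c \<in> {..<m}" "d \<in> {..<m}" "columns U `` {ppair c 0} = columns U `` {ppair d 0}"
    then have "ppair d 0 \<in> columns U `` {ppair c 0}" using full by (auto simp: columns_def)
    then show "c = d" by (simp add: columns_def)
  qed
  show "(\<lambda>c. columns U `` {ppair c 0}) ` {..<m} = classes U (columns U) infinite"
  proof (intro subset_antisym subsetI)
    fix M assume "M \<in> classes U (columns U) infinite"
    then obtain x where x: "x \<in> U" "M = columns U `` {x}" "pfst x < m"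
      by (auto simp: classes_def class_infinite_iff)
    then have "M = columns U `` {ppair (pfst x) 0}" using full by (simp add: columns_class)
    then show "M \<in> (\<lambda>c. columns U `` {ppair c 0}) ` {..<m}" using x by blast
  next
    fix M assume "M \<in> (\<lambda>c. columns U `` {ppair c 0}) ` {..<m}"
    then obtain c where c: "c < m" "M = columns U `` {ppair c 0}" by auto
    then have "ppair c 0 \<in> U" "infinite M" using full class_infinite_iff by auto
    with c(2) show "M \<in> classes U (columns U) infinite" unfolding classes_def by blast
  qed
qed

lemma infinite_classes: "finite (classes U (columns U) infinite)" "card (classes U (columns U) infinite) = m"
  using bij_betw_finite[OF bij_infinite_classes] bij_betw_same_card[OF bij_infinite_classes] by auto

lemma unbounded: "\<not> bounded_character U (columns U)"
proof
  assume "bounded_character U (columns U)"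
  then obtain k where k: "\<And>x. x \<in> U \<Longrightarrow> finite (columns U `` {x}) \<Longrightarrow> card (columns U `` {x}) \<le> k"
    by (auto simp: bounded_character_def)
  let ?x = "ppair (m + k) 0"
  have "?x \<in> U" "finite {i. ppair (m + k) i \<in> U}" using base fin by auto
  then have "card {i. ppair (m + k) i \<in> U} \<le> k" using k[of ?x] by (simp add: finite_columns_class card_columns_class)
  moreover have "card {..k} \<le> card {i. ppair (m + k) i \<in> U}"
    by (rule card_mono) (use \<open>finite _\<close> base in auto)
  ultimately show False by simp
qed

text \<open>In the unbounded case the number of infinite classes, if finite, determines the
  bi-embeddability type.\<close>

lemma copy:
  assumes A: "ces A E" and "\<not> bounded_character A E" "finite (classes A E infinite)"
    "card (classes A E infinite) = m"
  shows "comp_be_copy A E U (columns U)"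
  using embedding_unbounded[OF A ces_U] embedding_unbounded[OF ces_U A] assms unbounded infinite_classes
    comp_be_copyI[OF ces_U] by (metis order_refl)

end

text \<open>Column \<open>c >= m\<close> has exactly \<open>c - m + 1\<close> members, so its size
  can be read off the first coordinate of any member.\<close>

definition short_columns :: "nat \<Rightarrow> nat set" where
  "short_columns m = {z. pfst z < m \<or> psnd z \<le> pfst z - m}"

text \<open>When \<open>e\<close> enters the jump at stage \<open>s\<close>, column \<open>m + e\<close> receives the entries \<open>s, \<dots>, 2 s - 1\<close>.\<close>
definition jump_columns :: "nat \<Rightarrow> nat set" where
  "jump_columns m = {z. pfst z < m \<or> psnd z \<le> pfst z - m \<or>
     (pfst z - m \<in> jump_stage (chi {}) (psnd z) \<and> pfst z - m \<notin> jump_stage (chi {}) (psnd z div 2))}"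

lemma short_columns: "finitely_many_full_columns m (short_columns m)"
proof
  show "decides (chi {}) (\<lambda>x. x \<in> short_columns m)"
    unfolding short_columns_def mem_Collect_eq by (intro computability)
qed (auto simp: short_columns_def)

lemma jump_columns: "finitely_many_full_columns m (jump_columns m)"
proof
  show "decides (chi {}) (\<lambda>x. x \<in> jump_columns m)"
    unfolding jump_columns_def mem_Collect_eq by (intro computability decides_jump_stage computes_oracle[OF computes_id])
  fix c assume c: "m \<le> c"
  show "finite {i. ppair c i \<in> jump_columns m}"
  proof (cases "\<exists>t. c - m \<in> jump_stage (chi {}) t")
    case True
    then obtain t where t: "c - m \<in> jump_stage (chi {}) t" ..
    have "i < 2 * t" if "c - m \<notin> jump_stage (chi {}) (i div 2)" for i
    proof (rule ccontr)
      assume "\<not> i < 2 * t"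
      then have "t \<le> i div 2" by simp
      then show False using t that jump_stage_mono by blast
    qed
    then have "{i. ppair c i \<in> jump_columns m} \<subseteq> {..c} \<union> {..<2 * t}"
      using c by (auto simp: jump_columns_def)
    then show ?thesis by (rule finite_subset) simp
  next
    case False
    then have "{i. ppair c i \<in> jump_columns m} \<subseteq> {..c}" using c by (auto simp: jump_columns_def)
    then show ?thesis by (rule finite_subset) simp
  qed
qed (auto simp: jump_columns_def)

text \<open>The computation queries \<nu>; the presence of \<mu> guarantees that \<nu> sends a
  finite class to a finite class, without which the image would not bound anything.\<close>

lemma jump_from_embeddings:
  assumes \<mu>: "embedding (short_columns m) (columns (short_columns m)) (jump_columns m) (columns (jump_columns m)) \<mu>"
    and \<nu>: "embedding (jump_columns m) (columns (jump_columns m)) (short_columns m) (columns (short_columns m)) \<nu>"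
  shows "decides (join \<mu> \<nu>) (\<lambda>e. e \<in> jump {})"
proof -
  interpret U0: finitely_many_full_columns m "short_columns m" by (rule short_columns)
  interpret U1: finitely_many_full_columns m "jump_columns m" by (rule jump_columns)
  \<comment> \<open>The size of the short column that receives column \<open>m + e\<close>; by
    \<open>base\<close> the element with second coordinate 0 is always present.\<close>
  define s where "s e = Suc (pfst (\<nu> (ppair (m + e) 0)) - m)" for e
  have "e \<in> jump {} \<longleftrightarrow> e \<in> jump_stage (chi {}) (s e)" for e
  proof
    assume "e \<in> jump {}"
    then have ex: "\<exists>t. e \<in> jump_stage (chi {}) t" by (simp add: jump_iff_stage)
    define t where "t = (LEAST t. e \<in> jump_stage (chi {}) t)"
    have t: "e \<in> jump_stage (chi {}) t" using LeastI_ex[OF ex] by (simp add: t_def)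
    let ?x = "ppair (m + e) 0" and ?v = "\<nu> (ppair (m + e) 0)"
    have x: "?x \<in> jump_columns m" using U1.base by simp
    have v: "?v \<in> short_columns m" using embeddingD(1)[OF \<nu> x] .
    have fx: "finite (columns (jump_columns m) `` {?x})" using U1.class_infinite_iff[OF x] by simp
    have fv: "finite (columns (short_columns m) `` {?v})"
      by (rule finite_class_to_finite_class[OF ces_equiv[OF U1.ces_U] ces_equiv[OF U0.ces_U] \<nu> \<mu>
            U1.infinite_classes(1) x fx])
    then have m: "m \<le> pfst ?v" using U0.class_infinite_iff[OF v] by simp
    have "{t..<2 * t} \<subseteq> {i. ppair (m + e) i \<in> jump_columns m}"
    proof
      fix i assume i: "i \<in> {t..<2 * t}"
      then have "i div 2 < t" by auto
      then have "e \<notin> jump_stage (chi {}) (i div 2)" unfolding t_def by (rule not_less_Least)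
      moreover have "e \<in> jump_stage (chi {}) i" using t i jump_stage_mono[of t i] by auto
      ultimately show "i \<in> {i. ppair (m + e) i \<in> jump_columns m}" by (simp add: jump_columns_def)
    qed
    from card_mono[OF U1.fin this] have "t \<le> card (columns (jump_columns m) `` {?x})"
      using card_columns_class[OF x] by simp
    also have "\<dots> \<le> card (columns (short_columns m) `` {?v})"
      using embedding_dominates[OF ces_equiv[OF U1.ces_U] \<nu> x] fv by (simp add: dominates_def)
    also have "\<dots> = card {..pfst ?v - m}"
      using card_columns_class[OF v] m by (simp add: short_columns_def atMost_def)
    finally have "t \<le> s e" by (simp add: s_def)
    then show "e \<in> jump_stage (chi {}) (s e)" using t jump_stage_mono by blast
  qed (use jump_iff_stage in blast)
  moreover have "decides (join \<mu> \<nu>) (\<lambda>e. e \<in> jump_stage (chi {}) (s e))"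
  proof -
    have s: "s e = Suc (pfst (join \<mu> \<nu> (2 * ppair (m + e) 0 + 1)) - m)" for e
      by (simp add: s_def join_def)
    show ?thesis unfolding s
      by (intro computability decides_jump_stage) (auto simp: chi_def[abs_def] intro: computes_const)
  qed
  ultimately show ?thesis by simp
qed

section \<open>Infinitely many infinite classes: coding the double jump\<close>

text \<open>A column receives an entry for each \<open>z\<close> such that witnesses for all \<open>z' < z\<close> exist.\<close>
lemma ex_columns_Pi2:
  assumes Q: "decides (chi {}) (\<lambda>z. Q (pfst z) (pfst (psnd z)) (psnd (psnd z)))"
  obtains U where "decides (chi {}) (\<lambda>x. x \<in> U)" "\<And>c. infinite {i. ppair c i \<in> U} \<longleftrightarrow> (\<forall>z. \<exists>y. Q c z y)"
proof -
  define H where "H c z b \<longleftrightarrow> (\<forall>z'<z. \<exists>y<b. Q c z' y)" for c z b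
  \<comment> \<open>Only the least bound for each \<open>z\<close> is entered, so every
    \<open>z\<close> contributes at most one entry, and an infinite column has entries for
    arbitrarily large \<open>z\<close>.\<close>
  define U where "U = {x. H (pfst x) (pfst (psnd x)) (psnd (psnd x)) \<and> (\<forall>b<psnd (psnd x). \<not> H (pfst x) (pfst (psnd x)) b)}"
  have Q': "decides (chi {}) (\<lambda>x. Q (a x) (b x) (c x))" if "computes (chi {}) a" "computes (chi {}) b" "computes (chi {}) c" for a b c
    using decides_comp[OF Q, of "\<lambda>x. ppair (a x) (ppair (b x) (c x))"] that by (simp add: computes_ppair)
  have "decides (chi {}) (\<lambda>x. x \<in> U)" unfolding U_def H_def mem_Collect_eq by (intro computability Q')
  moreover have "infinite {i. ppair c i \<in> U} \<longleftrightarrow> (\<forall>z. \<exists>y. Q c z y)" for c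
  proof (rule iffI, rule allI)
    fix z assume inf: "infinite {i. ppair c i \<in> U}"
    have "\<exists>i. ppair c i \<in> U \<and> z < pfst i"
    proof (rule ccontr)
      assume no: "\<not> ?thesis"
      have "inj_on pfst {i. ppair c i \<in> U}"
      proof (rule inj_onI)
        fix i j assume ij: "i \<in> {i. ppair c i \<in> U}" "j \<in> {i. ppair c i \<in> U}" "pfst i = pfst j"
        then have "\<not> psnd i < psnd j" "\<not> psnd j < psnd i" by (auto simp: U_def)
        then show "i = j" using ij(3) by (metis linorder_neqE_nat ppair_pfst_psnd)
      qed
      moreover have "pfst ` {i. ppair c i \<in> U} \<subseteq> {..z}" using no by auto
      ultimately show False using inf inj_on_finite by blast
    qed
    then show "\<exists>y. Q c z y" by (auto simp: U_def H_def)
  next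
    assume all: "\<forall>z. \<exists>y. Q c z y"
    have "\<exists>i. ppair c i \<in> U \<and> pfst i = z" for z
    proof -
      have "\<forall>z'<z. \<exists>b. \<exists>y<b. Q c z' y" using all lessI by meson
      then have ex: "\<exists>b. H c z b" unfolding H_def
        by (rule common_bound[rotated]) (meson less_le_trans)
      then obtain b where "H c z b" "\<forall>b'<b. \<not> H c z b'" using exists_least_iff[of "H c z"] by blast
      then have "ppair c (ppair z b) \<in> U" by (simp add: U_def)
      then show ?thesis by (metis pfst_ppair)
    qed
    then have "pfst ` {i. ppair c i \<in> U} = UNIV" by (auto simp: image_iff) metis
    then show "infinite {i. ppair c i \<in> U}" using finite_imageI infinite_UNIV_nat by metis
  qed
  ultimately show ?thesis using that by blast
qed

section \<open>Reading lists off their codes\<close>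

text \<open>A nonempty list has code \<open>Suc (prod_encode (x, list_encode xs))\<close>, so
  \<open>psnd (c - 1)\<close> codes the tail. The code 0 of the empty list is a fixed point because
  \<open>psnd 0 = 0\<close>.\<close>

primrec drop_code :: "nat \<Rightarrow> nat \<Rightarrow> nat" where
  "drop_code c 0 = c"
| "drop_code c (Suc k) = psnd (drop_code c k - 1)"

lemma psnd_0 [simp]: "psnd 0 = 0"
  using le_ppair2[of "psnd 0" "pfst 0"] by simp

lemma drop_code: "drop_code c k = list_encode (drop k (list_decode c))"
proof (induction k)
  case (Suc k)
  show ?case
  proof (cases "drop k (list_decode c)")
    case Nil
    then show ?thesis using Suc by simp
  next
    case (Cons x xs)
    then have "drop (Suc k) (list_decode c) = xs" by (metis drop_Suc list.sel(3) tl_drop)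
    then show ?thesis using Suc Cons by (simp add: ppair_def[symmetric])
  qed
qed simp

lemma computes_drop_code [computability]: "computes f a \<Longrightarrow> computes f b \<Longrightarrow> computes f (\<lambda>x. drop_code (a x) (b x))"
proof -
  assume ab: "computes f a" "computes f b"
  have "drop_code c k = rec_nat c (\<lambda>i r. psnd (r - 1)) k" for c k by (induction k) auto
  then show ?thesis by (simp only:) (intro computability ab)
qed

definition entry :: "nat \<Rightarrow> nat \<Rightarrow> nat" where
  "entry c e = pfst (drop_code c e - 1)"

lemma entry: "e < length (list_decode c) \<Longrightarrow> entry c e = list_decode c ! e"
  using Cons_nth_drop_Suc[of e "list_decode c", symmetric]
  by (simp add: entry_def drop_code ppair_def[symmetric])

lemma drop_code_pos_iff: "0 < drop_code c e \<longleftrightarrow> e < length (list_decode c)"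
proof -
  have "list_encode xs = 0 \<longleftrightarrow> xs = []" for xs by (cases xs) auto
  then show ?thesis by (simp add: drop_code flip: not_less neq0_conv)
qed

lemma computes_entry [computability]: "computes f a \<Longrightarrow> computes f b \<Longrightarrow> computes f (\<lambda>x. entry (a x) (b x))"
  unfolding entry_def by (intro computability)

text \<open>Provides a computable bound for quantifiers over the positions of a coded list.\<close>

lemma length_list_decode_le: "length (list_decode c) \<le> c"
proof (induction c rule: list_decode.induct)
  case (2 n)
  obtain x y where xy: "prod_decode n = (x, y)" by force
  then have "y \<le> n" using le_prod_encode_2[of y x] prod_decode_inverse[of n] by metis
  then show ?case using 2 xy by (auto simp: le_trans)
qed simp

section \<open>Initial segments of the witness function\<close>

text \<open>The shift by \<open>Suc\<close> reserves 0 for absence from the double jump.\<close>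

definition witness :: "nat \<Rightarrow> nat" where
  "witness e = (if e \<in> jump (jump {}) then Suc (LEAST s. e \<in> jump_stage (chi (jump {})) s) else 0)"

text \<open>An embedding may select any infinite set of columns, so each infinite set of indices
  must carry all the information. Initial segments achieve this: infinitely many of them include
  arbitrarily long ones, and any segment longer than \<open>e\<close> decides
  \<open>e\<close>.\<close>

definition witness_code :: "nat \<Rightarrow> nat" where
  "witness_code n = list_encode (map witness [0..<n])"

lemma inj_witness_code: "inj witness_code"
proof (rule injI)
  fix m n assume "witness_code m = witness_code n"
  then have "map witness [0..<m] = map witness [0..<n]"
    by (metis witness_code_def list_encode_inverse)
  then show "m = n" by (metis diff_zero length_map length_upt)
qed

lemma length_witness_code: "length (list_decode (witness_code n)) = n"
  by (simp add: witness_code_def)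

lemma entry_witness_code: "e < n \<Longrightarrow> entry (witness_code n) e = witness e"
  by (subst entry) (simp_all add: witness_code_def)

lemma witness_code_iff:
  "c \<in> range witness_code \<longleftrightarrow> (\<forall>e<length (list_decode c). entry c e = witness e)"
proof
  assume *: "\<forall>e<length (list_decode c). entry c e = witness e"
  have "list_decode c = map witness [0..<length (list_decode c)]"
    by (rule nth_equalityI) (use * entry[of _ c] in auto)
  then have "c = witness_code (length (list_decode c))" by (metis witness_code_def list_decode_inverse)
  then show "c \<in> range witness_code" by blast
qed (auto simp: entry_witness_code length_witness_code)

text \<open>Relative to \<open>jump {}\<close>, being a witness code is a universal condition: absence from the double jump
  can be refuted at some stage, and whether a given stage is the least one is decidable.\<close>
lemma ex_witness_columns:
  obtains U where "decides (chi {}) (\<lambda>x. x \<in> U)"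
    "\<And>c. infinite {i. ppair c i \<in> U} \<longleftrightarrow> c \<in> range witness_code"
proof -
  let ?X = "jump {}"
  define V where "V e s \<longleftrightarrow> e \<in> jump_stage (chi ?X) s" for e s
  define W where "W c s \<longleftrightarrow> (\<forall>e<c. 0 < drop_code c e \<longrightarrow>
      (entry c e = 0 \<longrightarrow> \<not> V e s) \<and>
      (entry c e \<noteq> 0 \<longrightarrow> V e (entry c e - 1) \<and> (\<forall>s'<entry c e - 1. \<not> V e s')))" for c s
  have good: "(\<forall>s. (v = 0 \<longrightarrow> \<not> V e s) \<and> (v \<noteq> 0 \<longrightarrow> V e (v - 1) \<and> (\<forall>s'<v - 1. \<not> V e s')))
      \<longleftrightarrow> v = witness e" for e v
  proof (cases "e \<in> jump ?X")
    case False
    then show ?thesis using jump_iff_stage[of e ?X] by (auto simp: V_def witness_def)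
  next
    case True
    then have ex: "\<exists>s. V e s" using jump_iff_stage by (simp add: V_def)
    have least: "V e s \<and> (\<forall>s'<s. \<not> V e s') \<longleftrightarrow> s = (LEAST s. V e s)" for s
      using LeastI_ex[OF ex] not_less_Least[of _ "V e"] by (metis linorder_neqE_nat)
    show ?thesis
    proof (cases v)
      case 0
      then show ?thesis using ex True by (simp add: witness_def)
    next
      case (Suc s)
      then show ?thesis using least[of s] True by (simp add: witness_def V_def)
    qed
  qed
  have bound: "(\<forall>e<c. 0 < drop_code c e \<longrightarrow> R e) \<longleftrightarrow> (\<forall>e<length (list_decode c). R e)" for c and R
    using length_list_decode_le[of c] by (auto simp: drop_code_pos_iff)
  have W: "(\<forall>s. W c s) \<longleftrightarrow> c \<in> range witness_code" for c
    unfolding witness_code_iff good[symmetric] W_def bound by blast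
  have "decides (chi ?X) (\<lambda>z. W (pfst z) (psnd z))" unfolding W_def V_def
    by (intro computability decides_jump_stage computes_oracle[OF computes_id])
  then obtain Q where Q: "decides (chi {}) (\<lambda>z. Q (pfst z) (pfst (psnd z)) (psnd (psnd z)))"
    "\<And>x. W (pfst x) (psnd x) \<longleftrightarrow> (\<forall>a. \<exists>b. Q x a b)"
    using decides_jump_Pi2[of "{}" "\<lambda>z. W (pfst z) (psnd z)"] by metis
  \<comment> \<open>Pairing merges the quantifier over stages \<open>s\<close> with the universal
    quantifier of the Pi_2 form of \<open>W\<close>.\<close>
  define Q' where "Q' c z b \<longleftrightarrow> Q (ppair c (pfst z)) (psnd z) b" for c z b
  have "decides (chi {}) (\<lambda>z. Q' (pfst z) (pfst (psnd z)) (psnd (psnd z)))"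
  proof -
    have "computes (chi {}) (\<lambda>z. ppair (ppair (pfst z) (pfst (pfst (psnd z)))) (ppair (psnd (pfst (psnd z))) (psnd (psnd z))))" by (intro computability)
    from decides_comp[OF Q(1) this] show ?thesis by (simp add: Q'_def)
  qed
  moreover have "(\<forall>z. \<exists>b. Q' c z b) \<longleftrightarrow> c \<in> range witness_code" for c
  proof -
    have q1: "W c s \<longleftrightarrow> (\<forall>a. \<exists>b. Q (ppair c s) a b)" for s using Q(2)[of "ppair c s"] by simp
    have "(\<forall>z. \<exists>b. Q' c z b) \<longleftrightarrow> (\<forall>s a. \<exists>b. Q (ppair c s) a b)"
      unfolding Q'_def by (metis pfst_ppair psnd_ppair)
    then show ?thesis unfolding W[symmetric] q1 .
  qed
  ultimately show ?thesis using that ex_columns_Pi2[of Q'] by metis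
qed

lemma infinitely_many_infinite_columns:
  assumes "infinite {c. infinite {i. ppair c i \<in> U}}"
  shows "infinite (classes U (columns U) infinite)"
proof
  assume fin: "finite (classes U (columns U) infinite)"
  let ?cls = "\<lambda>c. ppair c ` {i. ppair c i \<in> U}"
  have "?cls ` {c. infinite {i. ppair c i \<in> U}} \<subseteq> classes U (columns U) infinite"
  proof (rule image_subsetI)
    fix c assume c: "c \<in> {c. infinite {i. ppair c i \<in> U}}"
    then obtain i where i: "ppair c i \<in> U" by (metis (mono_tags) Collect_empty_eq finite.emptyI mem_Collect_eq)
    then have "columns U `` {ppair c i} = ?cls c" using columns_class[OF i] by simp
    moreover have "infinite (?cls c)" using c by (simp add: finite_image_iff inj_ppair)
    ultimately show "?cls c \<in> classes U (columns U) infinite" using i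
      unfolding classes_def by (metis (mono_tags, lifting) mem_Collect_eq)
  qed
  moreover have "inj_on ?cls {c. infinite {i. ppair c i \<in> U}}"
  proof (rule inj_onI)
    fix c d assume cd: "c \<in> {c. infinite {i. ppair c i \<in> U}}" "?cls c = ?cls d"
    then obtain i where "ppair c i \<in> U" by (metis (mono_tags) Collect_empty_eq finite.emptyI mem_Collect_eq)
    then have "ppair c i \<in> ?cls d" using cd(2) by blast
    then show "c = d" by auto
  qed
  ultimately show False using assms fin inj_on_finite by blast
qed

text \<open>Distinct columns of \<open>UNIV\<close> go to infinite columns of \<open>U\<close> with
  distinct indices, all of them witness codes. Therefore some index codes a list longer than
  \<open>e\<close>; it is found by search, and its entry at \<open>e\<close> answers the
  question.\<close>

lemma double_jump_from_embedding:
  assumes U: "decides (chi {}) (\<lambda>x. x \<in> U)"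
    "\<And>c. infinite {i. ppair c i \<in> U} \<longleftrightarrow> c \<in> range witness_code"
    and \<mu>: "embedding UNIV (columns UNIV) U (columns U) \<mu>"
  shows "decides (join \<mu> \<nu>) (\<lambda>e. e \<in> jump (jump {}))"
proof -
  define c where "c k = pfst (\<mu> (ppair k 0))" for k
  have dU: "decides (chi {}) (\<lambda>x. x \<in> UNIV)" by (simp add: decides_const)
  have \<mu>U: "\<mu> x \<in> U" for x using embeddingD(1)[OF \<mu>] by simp
  have c_range: "c k \<in> range witness_code" for k
  proof -
    have "infinite (columns UNIV `` {ppair k 0})" by (simp add: finite_columns_class)
    from embedding_infinite_class[OF ces_equiv[OF ces_columns[OF dU]] \<mu> UNIV_I this]
    show ?thesis using U(2) finite_columns_class[OF \<mu>U] by (simp add: c_def)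
  qed
  have inj_c: "inj c"
  proof (rule injI)
    fix k l assume "c k = c l"
    then have "(\<mu> (ppair k 0), \<mu> (ppair l 0)) \<in> columns U" using \<mu>U by (simp add: columns_def c_def)
    then show "k = l" using embeddingD(3)[OF \<mu>] by (simp add: columns_def)
  qed
  have ex: "\<exists>k. 0 < drop_code (c k) e" for e
  proof (rule ccontr)
    assume *: "\<not> ?thesis"
    have "range c \<subseteq> witness_code ` {..e}"
    proof
      fix d assume "d \<in> range c"
      then obtain k n where "d = c k" "c k = witness_code n" using c_range by blast
      moreover from this have "n \<le> e"
        using * by (metis drop_code_pos_iff length_witness_code not_less)
      ultimately show "d \<in> witness_code ` {..e}" by simp
    qed
    then show False using inj_c finite_subset finite_imageD by blast
  qed
  define k where "k e = (LEAST k. 0 < drop_code (c k) e)" for e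
  have "e \<in> jump (jump {}) \<longleftrightarrow> 0 < entry (c (k e)) e" for e
  proof -
    obtain n where n: "c (k e) = witness_code n" using c_range by blast
    have "0 < drop_code (c (k e)) e" unfolding k_def by (rule LeastI_ex[OF ex])
    then have "e < n" by (simp add: n drop_code_pos_iff length_witness_code)
    then show ?thesis by (simp add: n entry_witness_code witness_def)
  qed
  moreover have "decides (join \<mu> \<nu>) (\<lambda>e. 0 < entry (c (k e)) e)"
  proof -
    have "c = (\<lambda>k. pfst (join \<mu> \<nu> (2 * ppair k 0)))" by (simp add: c_def[abs_def] join_def)
    then have c: "computes (join \<mu> \<nu>) c" by (simp only:) (intro computability)
    show ?thesis unfolding k_def using ex by (intro computability computes_comp[OF c])
  qed
  ultimately show ?thesis by simp
qed

section \<open>The three cases\<close>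

lemma strong_degree_bounded:
  assumes A: "ces A E" and "bounded_character A E" and fin: "finite (classes A E infinite)"
  shows "strong_degree_of_bec {} A E"
proof (rule strong_degreeI[OF A])
  have id: "embedding A E A E (\<lambda>x. x)" by (auto simp: embedding_def)
  \<comment> \<open>The empty set is decidable from any join, so \<open>A\<close> itself serves as
    both copies.\<close>
  show "comp_be_copy A E A E" "comp_be_copy A E A E" using comp_be_copyI[OF A id id] by auto
  show "decides (join \<mu> \<nu>) (\<lambda>x. x \<in> {})" for \<mu> \<nu> by (simp add: decides_const)
  fix B F C G assume B: "comp_be_copy A E B F" and C: "comp_be_copy A E C G"
  obtain \<mu> \<nu> where \<mu>: "ces B F" "embedding A E B F \<mu>" "embedding B F A E \<nu>" by (rule comp_be_copyE[OF B A])
  obtain \<mu>' \<nu>' where \<mu>': "ces C G" "embedding A E C G \<mu>'" "embedding C G A E \<nu>'" by (rule comp_be_copyE[OF C A])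
  have finB: "finite (classes B F infinite)" using infinite_classes_le[OF \<mu>(1) A \<mu>(3) fin] by simp
  have "bounded_character B F" by (rule bounded_character_transfer[OF \<mu>(1) A \<mu>(3,2) finB assms(2)])
  then show "\<exists>\<mu>. embedding B F C G \<mu> \<and> computes (chi {}) \<mu>"
    by (rule embedding_bounded[OF \<mu>(1) \<mu>'(1) _ finB embedding_comp[OF \<mu>(3) \<mu>'(2)]])
qed

lemma strong_degree_unbounded:
  assumes A: "ces A E" and ub: "\<not> bounded_character A E" and fin: "finite (classes A E infinite)"
  shows "strong_degree_of_bec (jump {}) A E"
proof (rule strong_degreeI[OF A])
  let ?m = "card (classes A E infinite)"
  show "comp_be_copy A E (short_columns ?m) (columns (short_columns ?m))"
    "comp_be_copy A E (jump_columns ?m) (columns (jump_columns ?m))"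
    using finitely_many_full_columns.copy[OF short_columns A ub fin]
      finitely_many_full_columns.copy[OF jump_columns A ub fin] by auto
  fix B F C G assume B: "comp_be_copy A E B F" and C: "comp_be_copy A E C G"
  obtain \<mu> \<nu> where \<mu>: "ces B F" "embedding A E B F \<mu>" "embedding B F A E \<nu>" by (rule comp_be_copyE[OF B A])
  obtain \<mu>' \<nu>' where \<mu>': "ces C G" "embedding A E C G \<mu>'" "embedding C G A E \<nu>'" by (rule comp_be_copyE[OF C A])
  have finB: "finite (classes B F infinite)" and leB: "card (classes B F infinite) \<le> ?m"
    using infinite_classes_le[OF \<mu>(1) A \<mu>(3) fin] by auto
  have finC: "finite (classes C G infinite)" using infinite_classes_le[OF \<mu>'(1) A \<mu>'(3) fin] by simp
  have "?m \<le> card (classes C G infinite)" using infinite_classes_le[OF A \<mu>'(1,2) finC] by simp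
  moreover have "\<not> bounded_character C G"
    using bounded_character_transfer[OF A \<mu>'(1,2,3) fin] ub by blast
  ultimately show "\<exists>\<mu>. embedding B F C G \<mu> \<and> computes (chi (jump {})) \<mu>"
    using embedding_unbounded[OF \<mu>(1) \<mu>'(1) _ finB finC] leB by simp
qed (rule jump_from_embeddings)

lemma strong_degree_infinitely_many:
  assumes A: "ces A E" and inf: "infinite (classes A E infinite)"
  shows "strong_degree_of_bec (jump (jump {})) A E"
proof -
  obtain U where U: "decides (chi {}) (\<lambda>x. x \<in> U)"
    "\<And>c. infinite {i. ppair c i \<in> U} \<longleftrightarrow> c \<in> range witness_code"
    using ex_witness_columns by metis
  have dU: "decides (chi {}) (\<lambda>x. x \<in> UNIV)" by (simp add: decides_const)
  have copy: "comp_be_copy A E V (columns V)"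
    if V: "decides (chi {}) (\<lambda>x. x \<in> V)" "infinite {c. infinite {i. ppair c i \<in> V}}" for V
    using embedding_infinitely_many[OF A ces_columns[OF V(1)] infinitely_many_infinite_columns[OF V(2)]]
      embedding_infinitely_many[OF ces_columns[OF V(1)] A inf] comp_be_copyI[OF ces_columns[OF V(1)]] by metis
  show ?thesis
  proof (rule strong_degreeI[OF A])
    show "comp_be_copy A E UNIV (columns UNIV)" by (rule copy[OF dU]) simp
    show "comp_be_copy A E U (columns U)"
      by (rule copy[OF U(1)]) (use finite_imageD[OF _ inj_witness_code] in \<open>auto simp: U(2)\<close>)
    show "decides (join \<mu> \<nu>) (\<lambda>x. x \<in> jump (jump {}))"
      if "embedding UNIV (columns UNIV) U (columns U) \<mu>" for \<mu> \<nu>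
      by (rule double_jump_from_embedding[OF U that])
    fix B F C G assume B: "comp_be_copy A E B F" and C: "comp_be_copy A E C G"
    obtain \<mu> \<nu> where \<mu>: "ces C G" "embedding A E C G \<mu>" "embedding C G A E \<nu>" by (rule comp_be_copyE[OF C A])
    have "infinite (classes C G infinite)" using infinite_classes_le[OF A \<mu>(1,2)] inf by blast
    then show "\<exists>\<mu>. embedding B F C G \<mu> \<and> computes (chi (jump (jump {}))) \<mu>"
      by (rule embedding_infinitely_many[OF comp_be_copy_ces[OF A B] \<mu>(1)])
  qed
qed

theorem theorem1p3:
  fixes A :: "nat set" and E :: "(nat \<times> nat) set"
  assumes "computable_equiv_structure A E"
  shows "(bounded_character A E \<and> finitely_many_infinite_classes A E
            \<longrightarrow> strong_degree_of_bec {} A E)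
       \<and> (\<not> bounded_character A E \<and> finitely_many_infinite_classes A E
            \<longrightarrow> strong_degree_of_bec (jump {}) A E)
       \<and> (\<not> finitely_many_infinite_classes A E
            \<longrightarrow> strong_degree_of_bec (jump (jump {})) A E)"
  using strong_degree_bounded[OF assms] strong_degree_unbounded[OF assms]
    strong_degree_infinitely_many[OF assms]
  by (simp add: finitely_many_infinite_classes_iff)

end
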